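(* Let $s_1,s_2,\dots$ be the focal values of plane systems of degree at most $3$, viewed as polynomials in the $14$ coefficients of $(p,q)$, and let $I_{11}=(s_1,\dots,s_{11})$ be the ideal generated by the first eleven of them in the polynomial ring over $\mathbb{C}$ in these $14$ variables. Then $s_{12}\notin \operatorname{rad} I_{11}$.
   Context: Consider $P(x,y)=x+p(x,y)$ and $Q(x,y)=y+q(x,y)$, where $p,q$ are polynomials of degree at most $3$ with only terms of degree $2$ and $3$; their $14$ coefficients are regarded as independent variables (associated plane autonomous system: $\dot x=Q(x,y)$, $\dot y=-P(x,y)$). Focal values: one can iteratively find a formal power series $F=x^2+y^2+f_3(x,y)+f_4(x,y)+\cdots$, with $f_k$ homogeneous of degree $k$ in $x,y$, such that $$\det\begin{pmatrix}F_x&F_y\\P&Q\end{pmatrix}=F_xQ-F_yP=\sum_{j=1}^\infty s_j\,(x^{2j+2}+y^{2j+2}),$$ where the $s_j$ (and the coefficients of the $f_k$) are polynomials with rational coefficients in the $14$ coefficients of $p$ and $q$. For odd $k$, $f_k$ is determined by the previous terms; for even $k$, it is determined up to adding a multiple of $(x^2+y^2)^{k/2}$. Fix any such choice (polynomial in the coefficients of $p,q$, with rational coefficients). The $s_j$ are called the focal values. *)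

theory Defs
  imports "HOL-Library.Poly_Mapping" "HOL-Computational_Algebra.Formal_Power_Series" Complex_Main
begin

text \<open>
  The fourteen indeterminates: \<open>Pij\<close> and \<open>Qij\<close> stand for the coefficient of
  \<open>x\<^sup>i y\<^sup>j\<close> in \<open>p\<close> and in \<open>q\<close>, respectively.
\<close>

datatype indet =
    P20 | P11 | P02 | P30 | P21 | P12 | P03
  | Q20 | Q11 | Q02 | Q30 | Q21 | Q12 | Q03

type_synonym 'k coeff_poly = "(indet \<Rightarrow>\<^sub>0 nat) \<Rightarrow>\<^sub>0 'k"

definition Var :: "indet \<Rightarrow> 'k::comm_ring_1 coeff_poly" where
  "Var v = Poly_Mapping.single (Poly_Mapping.single v 1) 1"

definition complex_poly :: "rat coeff_poly \<Rightarrow> complex coeff_poly" where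
  "complex_poly f = Poly_Mapping.map of_rat f"


text \<open>
  Power series in \<open>x\<close> and \<open>y\<close> over a ring \<open>R\<close> are elements of \<open>R[[x]][[y]]\<close>:
  the outer variable is \<open>y\<close>, the inner one is \<open>x\<close>.
\<close>

definition X :: "'r::comm_ring_1 fps fps" where
  "X = fps_const fps_X"

definition Y :: "'r::comm_ring_1 fps fps" where
  "Y = fps_X"

definition Const :: "'r::comm_ring_1 \<Rightarrow> 'r fps fps" where
  "Const c = fps_const (fps_const c)"

definition coeff_xy :: "'r::comm_ring_1 fps fps \<Rightarrow> nat \<Rightarrow> nat \<Rightarrow> 'r" where
  "coeff_xy F i j = fps_nth (fps_nth F j) i"

definition deriv_x :: "'r::comm_ring_1 fps fps \<Rightarrow> 'r fps fps" where
  "deriv_x F = Abs_fps (\<lambda>j. fps_deriv (fps_nth F j))"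

definition deriv_y :: "'r::comm_ring_1 fps fps \<Rightarrow> 'r fps fps" where
  "deriv_y F = fps_deriv F"


definition P_gen :: "'k::comm_ring_1 coeff_poly fps fps" where
  "P_gen = X
     + Const (Var P20) * X^2 + Const (Var P11) * X * Y + Const (Var P02) * Y^2
     + Const (Var P30) * X^3 + Const (Var P21) * X^2 * Y
     + Const (Var P12) * X * Y^2 + Const (Var P03) * Y^3"

definition Q_gen :: "'k::comm_ring_1 coeff_poly fps fps" where
  "Q_gen = Y
     + Const (Var Q20) * X^2 + Const (Var Q11) * X * Y + Const (Var Q02) * Y^2
     + Const (Var Q30) * X^3 + Const (Var Q21) * X^2 * Y
     + Const (Var Q12) * X * Y^2 + Const (Var Q03) * Y^3"

text \<open>
  The series \<open>\<Sum>k\<ge>1. s k (x\<^bsup>2k+2\<^esup> + y\<^bsup>2k+2\<^esup>)\<close>, summed coefficientwise: only the index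
  \<open>k\<close> with \<open>2k + 2 = i + j\<close> can contribute to the coefficient of \<open>x\<^sup>i y\<^sup>j\<close>.
\<close>

definition focal_series :: "(nat \<Rightarrow> 'r::comm_ring_1) \<Rightarrow> 'r fps fps" where
  "focal_series s = Abs_fps (\<lambda>j. Abs_fps (\<lambda>i.
     \<Sum>k = 1..i + j. coeff_xy (Const (s k) * (X^(2*k + 2) + Y^(2*k + 2))) i j))"

text \<open>
  The series \<open>F\<close> is not unique, so being a sequence of focal values is a relation; every
  admissible choice of \<open>F\<close> is covered. The value \<open>s 0\<close> is irrelevant.
\<close>

definition focal_expansion ::
  "rat coeff_poly fps fps \<Rightarrow> (nat \<Rightarrow> rat coeff_poly) \<Rightarrow> bool" where
  "focal_expansion F s \<longleftrightarrow>
     (\<forall>i j. i + j \<le> 2 \<longrightarrow> coeff_xy F i j = coeff_xy (X^2 + Y^2) i j) \<and>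
     deriv_x F * Q_gen - deriv_y F * P_gen = focal_series s"

definition focal_values :: "(nat \<Rightarrow> rat coeff_poly) \<Rightarrow> bool" where
  "focal_values s \<longleftrightarrow> (\<exists>F. focal_expansion F s)"


definition ideal_generated :: "'r::comm_ring_1 set \<Rightarrow> 'r set" where
  "ideal_generated A = module.span (*) A"

definition rad :: "'r::comm_ring_1 set \<Rightarrow> 'r set" where
  "rad I = {f. \<exists>n>0. f ^ n \<in> I}"

end

(* Proof idea.  Put z = x + iy and w = x - iy.  The system with
     z' = -i z (1 + w + c w^2),  w' = -i (-w + b w^2 + d w^3 + z^3)
   is invariant under z -> exp(2 pi i/3) z, so a formal first integral zw + ... contains
   only monomials z^(3k+1) w^n, and only the resonances (zw)^(3k+1) can obstruct it.  Hence the
   conditions s_1 = ... = s_11 = 0 reduce to three real equations in (b,c,d).  They have a common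
   real zero near (-0.5106102825680, 0.9506276237633, -0.3156455495269): a Newton map sends a
   cube of half-width 10^(-12) into itself, so Brouwer's theorem applies.  The obstruction at
   (zw)^13 stays near 0.001357 there.

   Independence of the choice of F: if G is a first integral up to order 26 with obstruction
   v (zw)^13, v nonzero, then any other admissible F agrees with a polynomial in G up to the first
   nonvanishing focal value, which therefore is s_12. *)
theory Submission
  imports Defs "HOL-Analysis.Brouwer_Fixpoint" "HOL-Library.Nonpos_Ints"
begin

section \<open>Order of vanishing and the derivation along the vector field\<close>

text \<open>A polynomial in the radical vanishes wherever the generators do, so one point of C^14
  suffices. The resonance (zw)^(3k+1) has degree 6k + 2 and hence concerns s_(3k): before s_12 there
  are as many equations as parameters. The field at this point does not preserve the real plane, but
  in the coordinates z, w, with the factor -i removed, the recursion for the first integral has real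
  coefficients; this is why real b, c, d and a real cube are enough. The zero need only exist: the
  bounds on the fourth obstruction hold on the whole cube and exclude 0. A further obstacle is that
  focal values are measured by x^d + y^d, the computed obstruction by (x^2+y^2)^(d/2). No conversion
  factor is computed. Both forms have nonnegative coefficients, and this sign condition alone keeps
  their nonzero multiples out of the image of the rotation operator.\<close>

lemma fps_fps_eqI: "(\<And>i j. coeff_xy F i j = coeff_xy G i j) \<Longrightarrow> F = G"
  by (simp add: coeff_xy_def fps_eq_iff)

lemma coeff_xy_Abs [simp]: "coeff_xy (Abs_fps (\<lambda>j. Abs_fps (\<lambda>i. f i j))) i j = f i j"
  by (simp add: coeff_xy_def)

lemma coeff_xy_add [simp]: "coeff_xy (F + G) i j = coeff_xy F i j + coeff_xy G i j"
  and coeff_xy_diff [simp]: "coeff_xy (F - G) i j = coeff_xy F i j - coeff_xy G i j"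
  and coeff_xy_zero [simp]: "coeff_xy 0 i j = 0"
  by (simp_all add: coeff_xy_def)

lemma coeff_xy_sum: "coeff_xy (sum f A) i j = (\<Sum>a\<in>A. coeff_xy (f a) i j)"
  by (simp add: coeff_xy_def fps_sum_nth)

lemma coeff_xy_mult:
  "coeff_xy (F * G) i j = (\<Sum>l=0..j. \<Sum>k=0..i. coeff_xy F k l * coeff_xy G (i - k) (j - l))"
  by (simp add: coeff_xy_def fps_mult_nth fps_sum_nth)

lemma coeff_xy_Const_mult [simp]: "coeff_xy (Const c * F) i j = c * coeff_xy F i j"
  by (simp add: coeff_xy_def Const_def)

lemma coeff_xy_X_mult: "coeff_xy (X * F) i j = (if i = 0 then 0 else coeff_xy F (i - 1) j)"
  by (simp add: coeff_xy_def X_def)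

lemma coeff_xy_Y_mult: "coeff_xy (Y * F) i j = (if j = 0 then 0 else coeff_xy F i (j - 1))"
  by (simp add: coeff_xy_def Y_def)

lemma coeff_xy_one: "coeff_xy 1 i j = (if i = 0 \<and> j = 0 then 1 else 0)"
  by (simp add: coeff_xy_def)

lemma coeff_xy_Const: "coeff_xy (Const c) i j = (if i = 0 \<and> j = 0 then c else 0)"
  by (simp add: coeff_xy_def Const_def)

lemma coeff_xy_X_power: "coeff_xy (X ^ m) i j = (if i = m \<and> j = 0 then 1 else 0)"
  by (induction m arbitrary: i) (auto simp: coeff_xy_one coeff_xy_X_mult)

lemma coeff_xy_Y_power: "coeff_xy (Y ^ m) i j = (if i = 0 \<and> j = m then 1 else 0)"
  by (induction m arbitrary: j) (auto simp: coeff_xy_one coeff_xy_Y_mult)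

lemma coeff_xy_X: "coeff_xy X i j = (if i = 1 \<and> j = 0 then 1 else 0)"
  and coeff_xy_Y: "coeff_xy Y i j = (if i = 0 \<and> j = 1 then 1 else 0)"
  using coeff_xy_X_power[of 1 i j] coeff_xy_Y_power[of 1 i j] by simp_all

lemma Const_add: "Const (a + b) = Const a + Const b"
  and Const_diff: "Const (a - b) = Const a - Const b"
  and Const_mult: "Const (a * b) = Const a * Const b"
  and Const_uminus: "Const (- a) = - Const a"
  and Const_0: "Const 0 = 0"
  and Const_1: "Const 1 = 1"
  by (simp_all add: Const_def fps_const_neg)

lemma Const_of_nat: "Const (of_nat n) = of_nat n"
  by (simp add: Const_def fps_of_nat)

lemma coeff_xy_deriv_x: "coeff_xy (deriv_x F) i j = of_nat (i + 1) * coeff_xy F (i + 1) j"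
  by (simp add: coeff_xy_def deriv_x_def)

lemma coeff_xy_deriv_y: "coeff_xy (deriv_y F) i j = of_nat (j + 1) * coeff_xy F i (j + 1)"
  by (simp add: coeff_xy_def deriv_y_def distrib_right flip: fps_of_nat)

lemma coeff_xy_focal_series:
  "coeff_xy (focal_series s) i j = (\<Sum>k=1..i+j. s k *
     ((if i = 2*k+2 \<and> j = 0 then 1 else 0) + (if i = 0 \<and> j = 2*k+2 then 1 else 0)))"
  by (simp only: focal_series_def coeff_xy_Abs coeff_xy_Const_mult coeff_xy_add coeff_xy_X_power coeff_xy_Y_power)


text \<open>Membership in the \<open>d\<close>-th power of the ideal generated by \<open>X\<close>
  and \<open>Y\<close>. It expresses congruence modulo terms of degree at least \<open>d\<close>, so
  that no homogeneous components have to be named.\<close>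

definition vanishes_below :: "nat \<Rightarrow> 'r::comm_ring_1 fps fps \<Rightarrow> bool" where
  "vanishes_below d F \<longleftrightarrow> (\<forall>i j. i + j < d \<longrightarrow> coeff_xy F i j = 0)"

lemma vanishes_below_0 [simp]: "vanishes_below 0 F"
  and vanishes_below_zero [simp]: "vanishes_below d 0"
  by (simp_all add: vanishes_below_def)

lemma vanishes_below_mono: "vanishes_below d F \<Longrightarrow> e \<le> d \<Longrightarrow> vanishes_below e F"
  by (auto simp: vanishes_below_def)

lemma vanishes_below_add: "vanishes_below d F \<Longrightarrow> vanishes_below d G \<Longrightarrow> vanishes_below d (F + G)"
  and vanishes_below_diff: "vanishes_below d F \<Longrightarrow> vanishes_below d G \<Longrightarrow> vanishes_below d (F - G)"
  by (simp_all add: vanishes_below_def)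

lemma vanishes_below_uminus: "vanishes_below d F \<Longrightarrow> vanishes_below d (- F)"
  using vanishes_below_diff[of d 0 F] by simp

lemma vanishes_below_sum: "(\<And>a. a \<in> A \<Longrightarrow> vanishes_below d (f a)) \<Longrightarrow> vanishes_below d (sum f A)"
  by (simp add: vanishes_below_def coeff_xy_sum)

lemma vanishes_below_mult:
  assumes "vanishes_below d F" "vanishes_below e G"
  shows "vanishes_below (d + e) (F * G)"
  unfolding vanishes_below_def
proof (intro allI impI)
  fix i j assume ij: "i + j < d + e"
  have "coeff_xy F k l * coeff_xy G (i - k) (j - l) = 0" if "l \<le> j" "k \<le> i" for k l
  proof (cases "k + l < d")
    case True
    then show ?thesis using assms(1) by (simp add: vanishes_below_def)
  next
    case False
    then have "(i - k) + (j - l) < e" using ij that by linarith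
    then show ?thesis using assms(2) by (simp add: vanishes_below_def)
  qed
  then show "coeff_xy (F * G) i j = 0"
    by (simp add: coeff_xy_mult)
qed

lemma vanishes_below_mult_left: "vanishes_below d G \<Longrightarrow> vanishes_below d (F * G)"
  using vanishes_below_mult[of 0 F d G] by simp

lemma vanishes_below_power: "vanishes_below d F \<Longrightarrow> vanishes_below (d * n) (F ^ n)"
  by (induction n) (auto intro: vanishes_below_mult)

lemma vanishes_below_X: "vanishes_below 1 X"
  and vanishes_below_Y: "vanishes_below 1 Y"
  by (auto simp: vanishes_below_def coeff_xy_X coeff_xy_Y)

lemma vanishes_below_deriv:
  assumes "vanishes_below d F"
  shows "vanishes_below (d - 1) (deriv_x F)" "vanishes_below (d - 1) (deriv_y F)"
  using assms by (auto simp: vanishes_below_def coeff_xy_deriv_x coeff_xy_deriv_y)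


section \<open>The derivation along the field \<open>x' = Q\<close>, \<open>y' = - P\<close>, whose
  linear part is a rotation\<close>

definition lie :: "'r::comm_ring_1 fps fps \<Rightarrow> 'r fps fps \<Rightarrow> 'r fps fps \<Rightarrow> 'r fps fps" where
  "lie P Q F = deriv_x F * Q - deriv_y F * P"

lemma deriv_x_add: "deriv_x (F + G) = deriv_x F + deriv_x G"
  and deriv_x_diff: "deriv_x (F - G) = deriv_x F - deriv_x G"
  by (rule fps_fps_eqI; simp add: coeff_xy_deriv_x algebra_simps)+

lemma deriv_x_mult: "deriv_x (F * G) = F * deriv_x G + deriv_x F * G"
  by (rule fps_ext) (simp add: deriv_x_def fps_mult_nth fps_deriv_sum sum.distrib)

lemma lie_add: "lie P Q (F + G) = lie P Q F + lie P Q G"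
  and lie_diff: "lie P Q (F - G) = lie P Q F - lie P Q G"
  and lie_mult: "lie P Q (F * G) = F * lie P Q G + lie P Q F * G"
  by (simp_all add: lie_def deriv_y_def deriv_x_add deriv_x_diff deriv_x_mult algebra_simps)

lemma lie_Const [simp]: "lie P Q (Const c) = 0"
proof -
  have "deriv_x (Const c) = 0" "deriv_y (Const c) = 0"
    by (rule fps_fps_eqI; simp add: coeff_xy_deriv_x coeff_xy_deriv_y coeff_xy_Const)+
  then show ?thesis by (simp add: lie_def)
qed

lemma lie_0 [simp]: "lie P Q 0 = 0"
  using lie_Const[of P Q 0] by (simp add: Const_0)

lemma lie_Const_mult: "lie P Q (Const c * F) = Const c * lie P Q F"
  by (simp add: lie_mult)

lemma lie_sum: "lie P Q (sum f A) = (\<Sum>a\<in>A. lie P Q (f a))"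
  by (induction A rule: infinite_finite_induct) (simp_all add: lie_add)

lemma lie_power: "lie P Q (F ^ Suc n) = of_nat (Suc n) * F ^ n * lie P Q F"
  by (induction n) (simp_all add: lie_mult algebra_simps)

lemma
  fixes P Q :: "'r::comm_ring_1 fps fps"
  shows lie_X: "lie P Q X = Q" and lie_Y: "lie P Q Y = - P"
proof -
  have "deriv_x X = (1 :: 'r fps fps)" "deriv_y X = (0 :: 'r fps fps)"
    "deriv_x Y = (0 :: 'r fps fps)" "deriv_y Y = (1 :: 'r fps fps)"
    by (rule fps_fps_eqI; auto simp: coeff_xy_deriv_x coeff_xy_deriv_y coeff_xy_one coeff_xy_X coeff_xy_Y)+
  then show "lie P Q X = Q" "lie P Q Y = - P" by (simp_all add: lie_def)
qed

text \<open>\<open>P - X\<close> and \<open>Q - Y\<close> have order at least 2, which pushes their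
  products with a derivative past degree \<open>d\<close>; only the rotation
  \<open>Y * deriv_x F - X * deriv_y F\<close> is left.\<close>

lemma coeff_lie_lowest:
  assumes P: "vanishes_below 2 (P - X)" and Q: "vanishes_below 2 (Q - Y)"
    and F: "vanishes_below d F" and d: "i + j = d" "d \<ge> 1"
  shows "coeff_xy (lie P Q F) i j =
    (if j = 0 then 0 else of_nat (i + 1) * coeff_xy F (i + 1) (j - 1))
    - (if i = 0 then 0 else of_nat (j + 1) * coeff_xy F (i - 1) (j + 1))"
proof -
  have "lie P Q F = Y * deriv_x F - X * deriv_y F + deriv_x F * (Q - Y) - deriv_y F * (P - X)"
    by (simp add: lie_def algebra_simps)
  moreover have "vanishes_below (d - 1 + 2) (deriv_x F * (Q - Y))" "vanishes_below (d - 1 + 2) (deriv_y F * (P - X))"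
    by (intro vanishes_below_mult vanishes_below_deriv assms)+
  ultimately show ?thesis
    using d by (auto simp: vanishes_below_def coeff_xy_Y_mult coeff_xy_X_mult coeff_xy_deriv_x coeff_xy_deriv_y)
qed

text \<open>
  Comparing the coefficients of \<open>x\<^bsup>d-j\<^esup> y\<^sup>j\<close> in \<open>y h\<^sub>x - x h\<^sub>y\<close> for a form \<open>h = \<Sum> g\<^sub>j x\<^bsup>d-j\<^esup> y\<^sup>j\<close> gives
  the hypothesis of the next three lemmas. A right-hand side with nonnegative coefficients is
  not in the image of this operator: the recursion starts at \<open>j = 0\<close> with one sign and ends
  at \<open>j = d\<close> with the other.
\<close>

lemma rotation_odd_coeff:
  fixes g :: "nat \<Rightarrow> complex"
  assumes eq: "\<And>j. j \<le> d \<Longrightarrow> (if j = 0 then 0 else of_nat (d - j + 1) * g (j - 1))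
      - (if j = d then 0 else of_nat (j + 1) * g (j + 1)) = \<sigma> * of_real (r j)"
    and r: "\<And>j. r j \<ge> 0" "r 0 > 0" and k: "2 * k + 1 < d"
  shows "\<exists>\<rho>>0. g (2 * k + 1) = - \<sigma> * of_real \<rho>"
  using k
proof (induction k)
  case 0
  then have "- g 1 = \<sigma> * of_real (r 0)" using eq[of 0] by simp
  then have "g 1 = - \<sigma> * of_real (r 0)" by (metis minus_minus mult_minus_left)
  then show ?case using r(2) by auto
next
  case (Suc k)
  then obtain \<rho> where \<rho>: "\<rho> > 0" "g (2 * k + 1) = - \<sigma> * of_real \<rho>" by auto
  define e where "e = d - (2 * k + 2) + 1"
  \<comment> \<open>The equation for \<open>j = 2 * k + 2\<close>, solved for the next odd
    coefficient and with \<open>- \<sigma>\<close> divided out; nothing negative enters, so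
    positivity propagates.\<close>
  define \<rho>' where "\<rho>' = (e * \<rho> + r (2 * k + 2)) / (2 * k + 3)"
  have "of_nat e * g (2 * k + 1) - of_nat (2 * k + 3) * g (2 * k + 3) = \<sigma> * of_real (r (2 * k + 2))"
    using eq[of "2 * k + 2"] Suc.prems by (auto simp: e_def eval_nat_numeral)
  then have "of_nat (2 * k + 3) * g (2 * k + 3) = of_nat e * g (2 * k + 1) - \<sigma> * of_real (r (2 * k + 2))"
    by algebra
  also have "\<dots> = - \<sigma> * of_real (e * \<rho> + r (2 * k + 2))"
    unfolding \<rho>(2) by (simp add: algebra_simps)
  finally have "of_nat (2 * k + 3) * g (2 * k + 3) = - \<sigma> * of_real (e * \<rho> + r (2 * k + 2))" .
  moreover have "(of_nat (2 * k + 3) :: complex) \<noteq> 0"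
    by (simp only: of_nat_eq_0_iff)
  ultimately have "g (2 * k + 3) = - \<sigma> * of_real \<rho>'"
    by (simp add: \<rho>'_def field_simps)
  moreover have "\<rho>' > 0"
    unfolding \<rho>'_def e_def using \<rho>(1) r(1)[of "2 * k + 2"] by (intro divide_pos_pos add_pos_nonneg mult_pos_pos) auto
  ultimately show ?case by (auto simp: eval_nat_numeral)
qed

lemma rotation_image:
  fixes g :: "nat \<Rightarrow> complex"
  assumes eq: "\<And>j. j \<le> d \<Longrightarrow> (if j = 0 then 0 else of_nat (d - j + 1) * g (j - 1))
      - (if j = d then 0 else of_nat (j + 1) * g (j + 1)) = \<sigma> * of_real (r j)"
    and r: "\<And>j. r j \<ge> 0" "r 0 > 0" and d: "even d" "d > 0"
  shows "\<sigma> = 0"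
proof -
  have "\<exists>k. d = 2 * k + 2" using d by presburger
  then obtain k where k: "d = 2 * k + 2" by blast
  obtain \<rho> where \<rho>: "\<rho> > 0" "g (2 * k + 1) = - \<sigma> * of_real \<rho>"
    using rotation_odd_coeff[OF eq r, of k] k by auto
  have "g (2 * k + 1) = \<sigma> * of_real (r d)"
    using eq[of d] by (simp add: k)
  with \<rho>(2) have "\<sigma> * of_real (r d) = - \<sigma> * of_real \<rho>" by simp
  then have "\<sigma> * of_real (r d + \<rho>) = 0"
    unfolding of_real_add distrib_left by simp
  moreover have "r d + \<rho> \<noteq> 0" using \<rho>(1) r(1)[of d] by linarith
  ultimately show ?thesis by (metis mult_eq_0_iff of_real_eq_0_iff)
qed

text \<open>The kernel is spanned by (x^2+y^2)^(d/2) for even \<open>d\<close> and is zero for odd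
  \<open>d\<close>. Since that form contains x^d, the condition \<open>g 0 = 0\<close> excludes
  it.\<close>

lemma rotation_kernel:
  fixes g :: "nat \<Rightarrow> complex"
  assumes eq: "\<And>j. j \<le> d \<Longrightarrow> (if j = 0 then 0 else of_nat (d - j + 1) * g (j - 1))
      - (if j = d then 0 else of_nat (j + 1) * g (j + 1)) = 0"
    and g0: "even d \<Longrightarrow> g 0 = 0" and j: "j \<le> d" "d > 0"
  shows "g j = 0"
proof -
  have g0: "g 0 = 0"
  proof (cases "even d")
    case False
    \<comment> \<open>The equation at \<open>j = d\<close> gives \<open>g (d - 1) = 0\<close>; for
      odd \<open>d\<close> this index is even, and descending by twos reaches
      \<open>g 0\<close>.\<close>
    have "g (d - 1 - 2 * k) = 0" if "2 * k \<le> d - 1" for k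
      using that
    proof (induction k)
      case 0
      then show ?case using eq[of d] j by simp
    next
      case (Suc k)
      define i where "i = d - 1 - 2 * k"
      have i: "i \<ge> 2" "i < d" using Suc.prems by (auto simp: i_def)
      obtain l where l: "i = Suc (Suc l)"
        using i(1) by (metis Suc_le_D numeral_2_eq_2 Suc_le_mono)
      have "g i = 0" using Suc by (simp add: i_def)
      then have "of_nat (d - Suc l + 1) * g l = 0"
        using eq[of "Suc l"] i unfolding l
        by (auto simp del: of_nat_Suc of_nat_add of_nat_diff)
      then have "g (i - 2) = 0"
        unfolding l by (simp only: mult_eq_0_iff of_nat_eq_0_iff) simp
      then show ?case by (simp add: i_def)
    qed
    from this[of "(d - 1) div 2"] show ?thesis using False j by auto
  qed (use g0 in simp)
  show ?thesis using j(1)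
  proof (induction j rule: less_induct)
    case (less j)
    consider "j = 0" | "j = 1" | i where "j = Suc (Suc i)"
      by (metis One_nat_def not0_implies_Suc)
    then show ?case
    proof cases
      case 2
      then show ?thesis using eq[of 0] less.prems by simp
    next
      case (3 i)
      then have "g i = 0" using less by simp
      then have "of_nat (Suc (Suc i)) * g (Suc (Suc i)) = 0"
        using eq[of "Suc i"] 3 less.prems by auto
      then show ?thesis unfolding 3 by (simp only: mult_eq_0_iff of_nat_eq_0_iff) simp
    qed (use g0 in simp)
  qed
qed

section \<open>Leading coefficients and the comparison of two expansions\<close>

lemma coeff_mult_lowest_x:
  assumes "vanishes_below d F" "vanishes_below e G"
  shows "coeff_xy (F * G) (d + e) 0 = coeff_xy F d 0 * coeff_xy G e 0"
proof -
  have "coeff_xy (F * G) (d + e) 0 = (\<Sum>k=0..d+e. coeff_xy F k 0 * coeff_xy G (d + e - k) 0)"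
    by (simp add: coeff_xy_mult)
  also have "\<dots> = (\<Sum>k=0..d+e. if k = d then coeff_xy F d 0 * coeff_xy G e 0 else 0)"
  proof (rule sum.cong)
    fix k assume "k \<in> {0..d+e}"
    then have "k = d \<or> k < d \<or> d + e - k < e" by auto
    then show "coeff_xy F k 0 * coeff_xy G (d + e - k) 0 = (if k = d then coeff_xy F d 0 * coeff_xy G e 0 else 0)"
      using assms by (auto simp: vanishes_below_def)
  qed simp
  finally show ?thesis by simp
qed

lemma coeff_power_lowest_x:
  assumes "vanishes_below 2 F"
  shows "coeff_xy (F ^ n) (2 * n) 0 = coeff_xy F 2 0 ^ n"
proof (induction n)
  case (Suc n)
  then show ?case
    using coeff_mult_lowest_x[OF assms vanishes_below_power[OF assms, of n]] by simp
qed (simp add: coeff_xy_one)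

lemma coeff_focal_series_odd: "odd (i + j) \<Longrightarrow> coeff_xy (focal_series s) i j = 0"
  unfolding coeff_xy_focal_series by (rule sum.neutral) auto

lemma coeff_focal_series_even:
  assumes "i + j = 2 * m + 2" "m \<ge> 1"
  shows "coeff_xy (focal_series s) i j = s m * ((if j = 0 then 1 else 0) + (if i = 0 then 1 else 0))"
proof -
  have "coeff_xy (focal_series s) i j =
      (\<Sum>k=1..i+j. if k = m then s m * ((if j = 0 then 1 else 0) + (if i = 0 then 1 else 0)) else 0)"
    unfolding coeff_xy_focal_series by (rule sum.cong) (use assms in auto)
  also have "m \<in> {1..i+j}" using assms by auto
  ultimately show ?thesis by (simp add: sum.delta)
qed

lemma nonneg_Reals_sum_I: "(\<And>a. a \<in> A \<Longrightarrow> f a \<in> \<real>\<^sub>\<ge>\<^sub>0) \<Longrightarrow> sum f A \<in> \<real>\<^sub>\<ge>\<^sub>0"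
  by (induction A rule: infinite_finite_induct) auto

text \<open>Supplies the weights \<open>r\<close> of \<open>rotation_image\<close> for a power of
  x^2+y^2. Nonnegative reals are closed under convolution, so no binomial coefficients are
  needed.\<close>

lemma coeff_circle_power_nonneg: "\<exists>r\<ge>0. coeff_xy ((X^2 + Y^2)^n :: complex fps fps) i j = of_real r"
proof -
  have "coeff_xy ((X^2 + Y^2)^n :: complex fps fps) i j \<in> \<real>\<^sub>\<ge>\<^sub>0"
  proof (induction n arbitrary: i j)
    case (Suc n)
    have "coeff_xy (X^2 + Y^2 :: complex fps fps) k l \<in> \<real>\<^sub>\<ge>\<^sub>0" for k l
      by (simp add: coeff_xy_X_power coeff_xy_Y_power)
    then have "coeff_xy ((X^2 + Y^2) * (X^2 + Y^2)^n :: complex fps fps) i j \<in> \<real>\<^sub>\<ge>\<^sub>0"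
      unfolding coeff_xy_mult by (intro nonneg_Reals_sum_I nonneg_Reals_mult_I Suc.IH)
    then show ?case by simp
  qed (simp add: coeff_xy_one)
  then show ?thesis by (auto elim: nonneg_Reals_cases)
qed

text \<open>In each degree \<open>d\<close> below 26 the lowest form of \<open>H - G - K\<close>
  solves the rotation equation whose right-hand side is the degree \<open>d\<close> part of the
  focal series. Solvability forces the focal value to vanish, and the remaining kernel element is
  absorbed into \<open>K\<close>. In degree 26, \<open>s 12 = 0\<close> would put a nonzero multiple
  of (x^2+y^2)^13 into the image.\<close>

lemma focal_value_obstruction:
  fixes P Q G H :: "complex fps fps"
  assumes P: "vanishes_below 2 (P - X)" and Q: "vanishes_below 2 (Q - Y)"
    and G: "vanishes_below 3 (G - (X^2 + Y^2))" and H: "vanishes_below 3 (H - (X^2 + Y^2))"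
    and lieG: "vanishes_below 27 (lie P Q G - Const c * (X^2 + Y^2)^13)" and c: "c \<noteq> 0"
    and lieH: "lie P Q H = focal_series s"
  shows "j \<in> {1..11} \<Longrightarrow> s j = 0" and "s 12 \<noteq> 0"
proof -
  have XY: "vanishes_below 2 (X^2 + Y^2 :: complex fps fps)"
    by (auto simp: vanishes_below_def coeff_xy_X_power coeff_xy_Y_power)
  have G2: "vanishes_below 2 G"
    using vanishes_below_add[OF vanishes_below_mono[OF G, of 2] XY] by simp
  have XY13: "vanishes_below 26 (Const c * (X^2 + Y^2)^13)"
    using vanishes_below_power[OF XY, of 13] by (intro vanishes_below_mult_left) simp
  have lieG26: "vanishes_below 26 (lie P Q G)"
    using vanishes_below_add[OF vanishes_below_mono[OF lieG, of 26] XY13] by simp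
  have G20: "coeff_xy G 2 0 = 1"
  proof -
    have "coeff_xy (G - (X^2 + Y^2)) 2 0 = 0" using G by (simp add: vanishes_below_def)
    then show ?thesis by (simp add: coeff_xy_X_power coeff_xy_Y_power)
  qed
  \<comment> \<open>\<open>G ^ (n - 1)\<close> has order at least 2 and \<open>lie P Q G\<close>
    order at least 26. For \<open>n = 1\<close> the first factor gains nothing, hence the
    restriction.\<close>
  have lie_G_power: "vanishes_below 27 (lie P Q (Const a * G ^ n))" if n: "n \<ge> 2" for a n
  proof -
    have "\<exists>m. n = Suc m \<and> m \<ge> 1" using n by presburger
    then obtain m where m: "n = Suc m" "m \<ge> 1" by blast
    have "vanishes_below (2 * m + 26) (of_nat (Suc m) * G ^ m * lie P Q G)"
      by (intro vanishes_below_mult vanishes_below_mult_left vanishes_below_power G2 lieG26)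
    then have "vanishes_below 27 (lie P Q (G ^ n))"
      unfolding m lie_power by (rule vanishes_below_mono) (use m in simp)
    then show ?thesis unfolding lie_Const_mult by (rule vanishes_below_mult_left)
  qed
  \<comment> \<open>\<open>K\<close> collects the terms of degree at least two of a polynomial in \<open>G\<close>.\<close>
  have approx: "\<exists>K. vanishes_below 27 (lie P Q K) \<and> vanishes_below d (H - G - K) \<and>
      (\<forall>m. 1 \<le> m \<and> 2 * m + 2 < d \<longrightarrow> s m = 0)" if "3 \<le> d" "d \<le> 26" for d
    using that
  proof (induction d rule: dec_induct)
    case base
    have "vanishes_below 3 (H - G - 0)"
      using vanishes_below_diff[OF H G] by simp
    then show ?case by (intro exI[of _ 0]) auto
  next
    case (step d)
    then obtain K where K: "vanishes_below 27 (lie P Q K)" "vanishes_below d (H - G - K)"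
      and s: "\<And>m. 1 \<le> m \<Longrightarrow> 2 * m + 2 < d \<Longrightarrow> s m = 0" by auto
    define W where "W = H - G - K"
    have W: "vanishes_below d W" using K(2) by (simp add: W_def)
    have d: "3 \<le> d" "d < 26" using step by auto
    have lieW: "coeff_xy (lie P Q W) i j = coeff_xy (focal_series s) i j" if "i + j = d" for i j
      using lieG26 K(1) that d unfolding W_def lie_diff lieH by (auto simp: vanishes_below_def)
    define n where "n = d div 2"
    \<comment> \<open>The lowest form of \<open>G ^ n\<close> is (x^2+y^2)^n, so subtracting
      \<open>a\<close> times this power removes x^d from \<open>W\<close>. In odd degree the kernel
      is zero and no correction is made.\<close>
    define a where "a = (if even d then coeff_xy W d 0 else 0)"
    define W' where "W' = W - Const a * G ^ n"
    have Gn: "vanishes_below d (Const a * G ^ n)"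
    proof (cases "even d")
      case True
      then have "d = 2 * n" by (simp add: n_def)
      then show ?thesis using vanishes_below_power[OF G2, of n] by (intro vanishes_below_mult_left) simp
    qed (simp add: a_def Const_0)
    have lieGn: "vanishes_below 27 (lie P Q (Const a * G ^ n))"
    proof (cases "even d")
      case True
      then show ?thesis using d by (intro lie_G_power) (auto simp: n_def elim!: evenE)
    qed (simp add: a_def Const_0)
    have W': "vanishes_below d W'" unfolding W'_def by (intro vanishes_below_diff W Gn)
    have lieW': "coeff_xy (lie P Q W') i j = coeff_xy (focal_series s) i j" if "i + j = d" for i j
      using lieW[OF that] lieGn that d unfolding W'_def lie_diff by (simp add: vanishes_below_def)
    define g where "g j = coeff_xy W' (d - j) j" for j
    have rot: "(if j = 0 then 0 else of_nat (d - j + 1) * g (j - 1))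
        - (if j = d then 0 else of_nat (j + 1) * g (j + 1)) = coeff_xy (focal_series s) (d - j) j"
      if "j \<le> d" for j
      using coeff_lie_lowest[OF P Q W', of "d - j" j] lieW'[of "d - j" j] that d
      by (auto simp: g_def Suc_diff_le)
    have s': "s m = 0" if "1 \<le> m" "2 * m + 2 < Suc d" for m
    proof (cases "2 * m + 2 = d")
      case True
      show ?thesis
      proof (rule rotation_image)
        \<comment> \<open>The weights come from x^d and y^d: 1 at both ends, 0 between.\<close>
        show "(if j = 0 then 0 else of_nat (d - j + 1) * g (j - 1))
            - (if j = d then 0 else of_nat (j + 1) * g (j + 1))
            = s m * of_real ((if j = 0 then 1 else 0) + (if j = d then 1 else 0))"
          if "j \<le> d" for j
          unfolding rot[OF that] using that True \<open>1 \<le> m\<close>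
          by (subst coeff_focal_series_even[of _ _ m]) auto
      qed (use True in auto)
    qed (use that s in auto)
    have "coeff_xy (focal_series s) i j = 0" if "i + j = d" for i j
    proof (cases "even d")
      case True
      then have "\<exists>m. d = 2 * m + 2 \<and> 1 \<le> m" using d by presburger
      then obtain m where m: "d = 2 * m + 2" "1 \<le> m" by blast
      then show ?thesis using s'[of m] that by (simp add: coeff_focal_series_even[of i j m])
    qed (rule coeff_focal_series_odd, use that in simp)
    with rot have rot0: "(if j = 0 then 0 else of_nat (d - j + 1) * g (j - 1))
        - (if j = d then 0 else of_nat (j + 1) * g (j + 1)) = 0" if "j \<le> d" for j
      using that by simp
    have "g 0 = 0" if "even d"
    proof -
      have "d = 2 * n" using that by (simp add: n_def)
      then have "coeff_xy (G ^ n) d 0 = 1" using coeff_power_lowest_x[OF G2, of n] G20 by simp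
      then show ?thesis using that by (simp add: g_def W'_def a_def)
    qed
    from rotation_kernel[OF rot0 this] d have g: "g j = 0" if "j \<le> d" for j
      using that by auto
    have "vanishes_below (Suc d) W'"
      unfolding vanishes_below_def
    proof (intro allI impI)
      fix i j assume "i + j < Suc d"
      then consider "i + j < d" | "i = d - j" "j \<le> d" by linarith
      then show "coeff_xy W' i j = 0"
        using W' g by cases (auto simp: vanishes_below_def g_def)
    qed
    moreover have "W' = H - G - (K + Const a * G ^ n)" by (simp add: W'_def W_def)
    moreover have "vanishes_below 27 (lie P Q (K + Const a * G ^ n))"
      unfolding lie_add by (intro vanishes_below_add K lieGn)
    ultimately show ?case using s' by auto
  qed
  obtain K where K: "vanishes_below 27 (lie P Q K)" "vanishes_below 26 (H - G - K)"
    and s: "\<And>m. 1 \<le> m \<Longrightarrow> 2 * m + 2 < 26 \<Longrightarrow> s m = 0"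
    using approx[of 26] by auto
  show "s j = 0" if "j \<in> {1..11}" using s that by auto
  show "s 12 \<noteq> 0"
  proof
    assume s12: "s 12 = 0"
    define W where "W = H - G - K"
    define g where "g j = coeff_xy W (26 - j) j" for j
    obtain r where r: "\<And>i j. r i j \<ge> 0"
      "\<And>i j. coeff_xy ((X^2 + Y^2)^13 :: complex fps fps) i j = of_real (r i j)"
      using coeff_circle_power_nonneg[of 13] by metis
    \<comment> \<open>With \<open>s 12 = 0\<close> the focal series has no part of degree 26, so
      only \<open>- lie P Q G\<close> contributes.\<close>
    have lieW: "coeff_xy (lie P Q W) i j = - c * of_real (r i j)" if "i + j = 26" for i j
    proof -
      have "coeff_xy (lie P Q G) i j = c * of_real (r i j)"
        using lieG that by (simp add: vanishes_below_def r(2))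
      moreover have "coeff_xy (focal_series s) i j = 0"
        using coeff_focal_series_even[of i j 12 s] s12 that by simp
      ultimately show ?thesis
        using K(1) that unfolding W_def lie_diff lieH by (simp add: vanishes_below_def)
    qed
    have "- c = 0"
    proof (rule rotation_image)
      show "(if j = 0 then 0 else of_nat (26 - j + 1) * g (j - 1))
          - (if j = 26 then 0 else of_nat (j + 1) * g (j + 1)) = - c * of_real (r (26 - j) j)"
        if "j \<le> 26" for j
      proof -
        have "Suc (26 - j) = 27 - j" using that by simp
        then show ?thesis
          using coeff_lie_lowest[OF P Q K(2)[folded W_def], of "26 - j" j] lieW[of "26 - j" j] that
          by (auto simp: g_def)
      qed
      have "complex_of_real (r 26 0) = 1"
        using coeff_power_lowest_x[OF XY, of 13] by (simp add: r(2) coeff_xy_X_power coeff_xy_Y_power)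
      then show "r (26 - 0) 0 > 0" by simp
    qed (use r(1) in auto)
    with c show False by simp
  qed
qed

section \<open>The symmetric family\<close>

lemma sum_atMost_shift:
  fixes g :: "nat \<Rightarrow> 'a::comm_monoid_add"
  assumes "g 0 = 0" "g (Suc N) = 0"
  shows "(\<Sum>n\<le>N. g (Suc n)) = (\<Sum>n\<le>N. g n)"
proof -
  have "(\<Sum>n\<le>N. g (Suc n)) = (\<Sum>n\<le>Suc N. g n)"
    using assms(1) by (simp only: sum.atMost_Suc_shift) simp
  then show ?thesis using assms(2) by simp
qed

definition Z :: "complex fps fps" where "Z = X + Const \<i> * Y"
definition W :: "complex fps fps" where "W = X - Const \<i> * Y"

text \<open>Chosen so that the derivation \<open>lie P0 Q0\<close> takes the values stated in lemmas \<open>lie_Z\<close> and \<open>lie_W\<close> below.\<close>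

definition P0 :: "complex \<Rightarrow> complex \<Rightarrow> complex \<Rightarrow> complex fps fps" where
  "P0 b c d = X + Const (1/2) * (Z * W + Const c * Z * W^2 - (Const b * W^2 + Const d * W^3 + Z^3))"
definition Q0 :: "complex \<Rightarrow> complex \<Rightarrow> complex \<Rightarrow> complex fps fps" where
  "Q0 b c d = Y - Const (\<i>/2) * (Z * W + Const c * Z * W^2 + (Const b * W^2 + Const d * W^3 + Z^3))"

lemma Const_i_squared: "Const \<i> * Const \<i> = -1" "Const \<i> * (Const \<i> * F) = - F"
proof -
  show *: "Const \<i> * Const \<i> = -1"
    by (simp flip: Const_mult add: Const_uminus Const_1)
  then show "Const \<i> * (Const \<i> * F) = - F"
    by (simp flip: mult.assoc)
qed

lemma Z_mult_W: "Z * W = X^2 + Y^2"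
  by (simp add: Z_def W_def algebra_simps power2_eq_square Const_i_squared)

text \<open>\<open>Z\<close> and \<open>W\<close> have derivatives \<open>Q0 - i P0\<close> and
  \<open>Q0 + i P0\<close>. With \<open>h = 1/2\<close> each combination isolates one of the
  nonlinear parts \<open>s\<close> and \<open>t\<close>.\<close>

lemma half_identities:
  fixes x y i h s t :: "'a::comm_ring"
  shows "(y - i * h * (s + t)) - i * (x + h * (s - t)) = (y - i * x) - i * ((h + h) * s)"
    and "(y - i * h * (s + t)) + i * (x + h * (s - t)) = (y + i * x) - i * ((h + h) * t)"
  by (simp_all add: algebra_simps)

lemma
  shows lie_Z: "lie (P0 b c d) (Q0 b c d) Z = - (Const \<i> * (Z * (1 + W + Const c * W^2)))"
    and lie_W: "lie (P0 b c d) (Q0 b c d) W = - (Const \<i> * (- W + Const b * W^2 + Const d * W^3 + Z^3))"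
proof -
  have half: "Const (1/2) + Const (1/2) = (1 :: complex fps fps)" by (simp flip: Const_add add: Const_1)
  have i2: "Const (\<i>/2) = Const \<i> * Const (1/2)" by (simp flip: Const_mult)
  have Y: "Y - Const \<i> * X = - (Const \<i> * Z)" "Y + Const \<i> * X = Const \<i> * W"
    by (simp_all add: Z_def W_def distrib_left right_diff_distrib Const_i_squared)
  have "lie (P0 b c d) (Q0 b c d) Z = Q0 b c d - Const \<i> * P0 b c d"
    unfolding Z_def by (simp add: lie_add lie_Const_mult lie_X lie_Y)
  also have "\<dots> = - (Const \<i> * Z) - Const \<i> * (Z * W + Const c * Z * W^2)"
    unfolding P0_def Q0_def i2 half_identities half Y by simp
  finally show "lie (P0 b c d) (Q0 b c d) Z = - (Const \<i> * (Z * (1 + W + Const c * W^2)))"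
    by (simp add: algebra_simps)
  have "lie (P0 b c d) (Q0 b c d) W = Q0 b c d + Const \<i> * P0 b c d"
    unfolding W_def by (simp add: lie_diff lie_Const_mult lie_X lie_Y)
  also have "\<dots> = Const \<i> * W - Const \<i> * (Const b * W^2 + Const d * W^3 + Z^3)"
    unfolding P0_def Q0_def i2 half_identities half Y by simp
  finally show "lie (P0 b c d) (Q0 b c d) W = - (Const \<i> * (- W + Const b * W^2 + Const d * W^3 + Z^3))"
    by (simp add: algebra_simps)
qed

lemma vanishes_below_Z: "vanishes_below 1 Z" and vanishes_below_W: "vanishes_below 1 W"
  unfolding Z_def W_def
  by (intro vanishes_below_add vanishes_below_diff vanishes_below_mult_left vanishes_below_X vanishes_below_Y)+

lemma vanishes_below_P0: "vanishes_below 2 (P0 b c d - X)"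
  and vanishes_below_Q0: "vanishes_below 2 (Q0 b c d - Y)"
proof -
  have z: "vanishes_below 2 (Z * W)" "vanishes_below 2 (W^2)" "vanishes_below 2 (W^3)" "vanishes_below 2 (Z^3)"
    using vanishes_below_mult[OF vanishes_below_Z vanishes_below_W]
      vanishes_below_power[OF vanishes_below_W, of 2]
      vanishes_below_mono[OF vanishes_below_power[OF vanishes_below_W, of 3], of 2]
      vanishes_below_mono[OF vanishes_below_power[OF vanishes_below_Z, of 3], of 2]
    by (simp_all add: numeral_2_eq_2)
  show "vanishes_below 2 (P0 b c d - X)" "vanishes_below 2 (Q0 b c d - Y)"
    unfolding P0_def Q0_def
    using z by (auto intro!: vanishes_below_add vanishes_below_diff vanishes_below_uminus vanishes_below_mult_left
        simp: mult.assoc)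
qed

text \<open>The product rule for z^m w^n, with the factors written as \<open>p * z\<close> and
  \<open>q * w\<close>. The second identity serves \<open>n = 0\<close>, where no \<open>w\<close>
  can be split off.\<close>

lemma monomial_identities:
  fixes z w :: "'a::comm_ring_1"
  shows "p * z * (n * q * - (i * (- w + b * w^2 + d * w^3 + z^3))) + m * p * - (i * (z * (1 + w + c * w^2))) * (q * w)
      = - (i * ((m - n) * (p * z * (q * w)) + (m + n * b) * (p * z * (q * w * w))
         + (m * c + n * d) * (p * z * (q * w * w * w)) + n * (p * z * z^3 * q)))"
    and "m * p * - (i * (z * (1 + w + c * w^2)))
      = - (i * (m * (p * z) + m * (p * z * w) + m * c * (p * z * w * w)))"
  by (simp_all add: algebra_simps power2_eq_square power3_eq_cube)

text \<open>The exponent of \<open>Z\<close> changes by 0 or 3 only, which is the threefold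
  symmetry. For \<open>n = 0\<close> the truncated exponent \<open>n - 1\<close> is harmless, since
  its coefficient is 0.\<close>

lemma lie_monomial:
  "lie (P0 b c d) (Q0 b c d) (Z ^ Suc m * W ^ n) = - (Const \<i> *
     (Const (of_nat (Suc m) - of_nat n) * (Z ^ Suc m * W ^ n)
      + Const (of_nat (Suc m) + of_nat n * b) * (Z ^ Suc m * W ^ Suc n)
      + Const (of_nat (Suc m) * c + of_nat n * d) * (Z ^ Suc m * W ^ Suc (Suc n))
      + Const (of_nat n) * (Z ^ (Suc m + 3) * W ^ (n - 1))))"
proof -
  note Const_simps = Const_add Const_diff Const_mult Const_of_nat
  have Z: "lie (P0 b c d) (Q0 b c d) (Z ^ Suc m) = of_nat (Suc m) * Z ^ m * - (Const \<i> * (Z * (1 + W + Const c * W^2)))"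
    by (simp only: lie_power lie_Z)
  show ?thesis
  proof (cases n)
    case 0
    have "lie (P0 b c d) (Q0 b c d) (Z ^ Suc m * W ^ n) = lie (P0 b c d) (Q0 b c d) (Z ^ Suc m)"
      by (simp add: 0)
    also have "\<dots> = - (Const \<i> * (of_nat (Suc m) * (Z ^ m * Z) + of_nat (Suc m) * (Z ^ m * Z * W)
        + of_nat (Suc m) * Const c * (Z ^ m * Z * W * W)))"
      unfolding Z monomial_identities(2) ..
    finally show ?thesis
      unfolding 0 Const_simps of_nat_0 by (simp add: Const_0 mult_ac del: of_nat_Suc)
  next
    case (Suc l)
    have W: "lie (P0 b c d) (Q0 b c d) (W ^ n)
      = of_nat n * W ^ l * - (Const \<i> * (- W + Const b * W^2 + Const d * W^3 + Z^3))"
      unfolding Suc lie_power lie_W ..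
    have "lie (P0 b c d) (Q0 b c d) (Z ^ Suc m * W ^ n) = Z ^ m * Z * lie (P0 b c d) (Q0 b c d) (W ^ n)
        + lie (P0 b c d) (Q0 b c d) (Z ^ Suc m) * (W ^ l * W)"
      unfolding lie_mult[of _ _ "Z ^ Suc m"] by (simp only: Suc power_Suc2)
    also note W
    also note Z
    also note monomial_identities(1)
    note eq = trans[OF calculation this]
    have Z3: "Z ^ (Suc m + 3) = Z ^ m * Z * Z ^ 3"
      by (simp only: power_add power_Suc2)
    show ?thesis
      using eq unfolding Suc Const_simps Z3 by (simp only: power_Suc2 diff_Suc_1 mult_ac)
  qed
qed

section \<open>A point of the family where the first three obstructions vanish\<close>

text \<open>
  With \<open>m = 3k+1\<close>, this is the coefficient of \<open>z\<^sup>m w\<^sup>n\<close> in the first integral, solved for from the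
  vanishing of the coefficient of \<open>z\<^sup>m w\<^sup>n\<close> in its derivative. At a resonance \<open>n = m\<close> the
  coefficient is free; dividing by 1 there makes it equal to the obstruction itself.
\<close>

fun integral_coeff :: "real \<Rightarrow> real \<Rightarrow> real \<Rightarrow> nat \<Rightarrow> nat \<Rightarrow> real" where
  "integral_coeff b c d k n = (if k = 0 \<and> n = 1 then 1 else
     ((real (3*k+1) + (real n - 1) * b) * (if n = 0 then 0 else integral_coeff b c d k (n - 1))
    + (real (3*k+1) * c + (real n - 2) * d) * (if n < 2 then 0 else integral_coeff b c d k (n - 2))
    + (real n + 1) * (if k = 0 then 0 else integral_coeff b c d (k - 1) (n + 1)))
     / (if n = 3*k+1 then 1 else real n - real (3*k+1)))"

declare integral_coeff.simps [simp del]

text \<open>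
  A tuple \<open>(f0, f1, f2, f3, e)\<close> encloses \<open>10^25 x\<close> by \<open>f0 + f1 u + f2 v + f3 w\<close> up to \<open>e\<close>, where
  \<open>u, v, w\<close> in \<open>[-1,1]\<close> are the offsets of \<open>b, c, d\<close> from the approximate zero in units of \<open>10^(-12)\<close>.
\<close>

type_synonym taylor = "int \<times> int \<times> int \<times> int \<times> int"

fun encl :: "real \<Rightarrow> real \<Rightarrow> real \<Rightarrow> taylor \<Rightarrow> real \<Rightarrow> bool" where
  "encl u v w (f0,f1,f2,f3,e) x \<longleftrightarrow> \<bar>10^25 * x - (f0 + f1 * u + f2 * v + f3 * w)\<bar> \<le> e"

text \<open>One recursion step times 10^14, decided in integers. \<open>g\<close>, \<open>f\<close>
  and \<open>p\<close> enclose the entries at \<open>n - 2\<close>, at \<open>n - 1\<close>, and at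
  \<open>n + 1\<close> in the previous row. \<open>P\<close>, \<open>Q\<close>, \<open>R\<close> are
  the recursion coefficients at the centre of the cube and \<open>a1\<close>, \<open>a2\<close>,
  \<open>a3\<close> their slopes, with 100 = 10^14 * 10^(-12). The four residuals are rounding
  errors of the constant and linear parts; the rest bounds quadratic terms and inherited
  errors.\<close>

definition step_ok :: "int \<Rightarrow> int \<Rightarrow> taylor \<Rightarrow> taylor \<Rightarrow> taylor \<Rightarrow> taylor \<Rightarrow> bool" where
  "step_ok m n g f p h \<longleftrightarrow>
    (case (g, f, p, h) of ((g0,g1,g2,g3,ge), (f0,f1,f2,f3,fe), (p0,p1,p2,p3,pe), (h0,h1,h2,h3,he)) \<Rightarrow>
     let P = 10^14 * m + (n - 1) * (- 51061028256798);
         Q = m * 95062762376333 + (n - 2) * (- 31564554952688);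
         R = 10^14 * (n + 1);
         D = 10^14 * (if n = m then 1 else n - m);
         a1 = 100 * (n - 1); a2 = 100 * m; a3 = 100 * (n - 2)
     in \<bar>P*f0 + Q*g0 + R*p0 - D*h0\<bar> + \<bar>P*f1 + Q*g1 + R*p1 + a1*f0 - D*h1\<bar>
        + \<bar>P*f2 + Q*g2 + R*p2 + a2*g0 - D*h2\<bar> + \<bar>P*f3 + Q*g3 + R*p3 + a3*g0 - D*h3\<bar>
        + \<bar>a1\<bar> * (\<bar>f1\<bar> + \<bar>f2\<bar> + \<bar>f3\<bar>) + (\<bar>a2\<bar> + \<bar>a3\<bar>) * (\<bar>g1\<bar> + \<bar>g2\<bar> + \<bar>g3\<bar>)
        + (\<bar>P\<bar> + \<bar>a1\<bar>) * fe + (\<bar>Q\<bar> + (\<bar>a2\<bar> + \<bar>a3\<bar>)) * ge + R * pe \<le> \<bar>D\<bar> * he)"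

section \<open>Soundness of the integer test\<close>

lemma abs_lincomb_le:
  fixes u v w :: real
  assumes "\<bar>u\<bar> \<le> 1" "\<bar>v\<bar> \<le> 1" "\<bar>w\<bar> \<le> 1"
  shows "\<bar>x * u + y * v + z * w\<bar> \<le> \<bar>x\<bar> + \<bar>y\<bar> + \<bar>z\<bar>"
proof -
  have "\<bar>x * u\<bar> \<le> \<bar>x\<bar>" "\<bar>y * v\<bar> \<le> \<bar>y\<bar>" "\<bar>z * w\<bar> \<le> \<bar>z\<bar>"
    using assms by (simp_all add: abs_mult mult_left_le)
  then show ?thesis by linarith
qed

lemma abs_sum7_le:
  fixes a b c d e f g :: real
  assumes "\<bar>a\<bar> \<le> A" "\<bar>b\<bar> \<le> B" "\<bar>c\<bar> \<le> C" "\<bar>d\<bar> \<le> D" "\<bar>e\<bar> \<le> E" "\<bar>f\<bar> \<le> F" "\<bar>g\<bar> \<le> G"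
  shows "\<bar>a + b + c + d + e + f + g\<bar> \<le> A + B + C + D + E + F + G"
  using assms by linarith

lemma step_bound:
  fixes u v w P Q R D :: real
  assumes u: "\<bar>u\<bar> \<le> 1" "\<bar>v\<bar> \<le> 1" "\<bar>w\<bar> \<le> 1" and "R \<ge> 0" "D \<noteq> 0"
    and F: "\<bar>xf - (f0 + f1 * u + f2 * v + f3 * w)\<bar> \<le> fe"
    and G: "\<bar>xg - (g0 + g1 * u + g2 * v + g3 * w)\<bar> \<le> ge"
    and Pp: "\<bar>xp - (p0 + p1 * u + p2 * v + p3 * w)\<bar> \<le> pe"
    and x: "D * x = (P + a1 * u) * xf + (Q + a2 * v + a3 * w) * xg + R * xp"
    and ok: "\<bar>P*f0 + Q*g0 + R*p0 - D*h0\<bar> + \<bar>P*f1 + Q*g1 + R*p1 + a1*f0 - D*h1\<bar>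
        + \<bar>P*f2 + Q*g2 + R*p2 + a2*g0 - D*h2\<bar> + \<bar>P*f3 + Q*g3 + R*p3 + a3*g0 - D*h3\<bar>
        + \<bar>a1\<bar> * (\<bar>f1\<bar> + \<bar>f2\<bar> + \<bar>f3\<bar>) + (\<bar>a2\<bar> + \<bar>a3\<bar>) * (\<bar>g1\<bar> + \<bar>g2\<bar> + \<bar>g3\<bar>)
        + (\<bar>P\<bar> + \<bar>a1\<bar>) * fe + (\<bar>Q\<bar> + (\<bar>a2\<bar> + \<bar>a3\<bar>)) * ge + R * pe \<le> \<bar>D\<bar> * he"
  shows "\<bar>x - (h0 + h1 * u + h2 * v + h3 * w)\<bar> \<le> he"
proof -
  let ?F = "xf - (f0 + f1 * u + f2 * v + f3 * w)" and ?G = "xg - (g0 + g1 * u + g2 * v + g3 * w)"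
    and ?P = "xp - (p0 + p1 * u + p2 * v + p3 * w)"
  let ?r0 = "P*f0 + Q*g0 + R*p0 - D*h0" and ?r1 = "P*f1 + Q*g1 + R*p1 + a1*f0 - D*h1"
    and ?r2 = "P*f2 + Q*g2 + R*p2 + a2*g0 - D*h2" and ?r3 = "P*f3 + Q*g3 + R*p3 + a3*g0 - D*h3"
  \<comment> \<open>An exact expansion: residuals, two products of linear forms that a first-order
    enclosure cannot hold, and inherited errors.\<close>
  have eq: "D * (x - (h0 + h1 * u + h2 * v + h3 * w)) =
      ?r0 + (?r1 * u + ?r2 * v + ?r3 * w)
      + (a1 * u) * (f1 * u + f2 * v + f3 * w) + (a2 * v + a3 * w) * (g1 * u + g2 * v + g3 * w)
      + (P + a1 * u) * ?F + (Q + (a2 * v + a3 * w)) * ?G + R * ?P"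
    unfolding right_diff_distrib x by (simp add: algebra_simps)
  have a1: "\<bar>a1 * u\<bar> \<le> \<bar>a1\<bar>" and a2: "\<bar>a2 * v + a3 * w\<bar> \<le> \<bar>a2\<bar> + \<bar>a3\<bar>"
    using abs_lincomb_le[OF u, of a1 0 0] abs_lincomb_le[OF u, of 0 a2 a3] by simp_all
  have 1: "\<bar>(P + a1 * u) * ?F\<bar> \<le> (\<bar>P\<bar> + \<bar>a1\<bar>) * fe"
    unfolding abs_mult by (rule mult_mono[OF _ F]) (use a1 in auto)
  have 2: "\<bar>(Q + (a2 * v + a3 * w)) * ?G\<bar> \<le> (\<bar>Q\<bar> + (\<bar>a2\<bar> + \<bar>a3\<bar>)) * ge"
    unfolding abs_mult by (rule mult_mono[OF _ G]) (use a2 in auto)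
  have 3: "\<bar>R * ?P\<bar> \<le> R * pe"
    unfolding abs_mult using Pp \<open>R \<ge> 0\<close> by (simp add: mult_left_mono)
  have 4: "\<bar>?r1 * u + ?r2 * v + ?r3 * w\<bar> \<le> \<bar>?r1\<bar> + \<bar>?r2\<bar> + \<bar>?r3\<bar>"
    by (rule abs_lincomb_le[OF u])
  have 5: "\<bar>(a1 * u) * (f1 * u + f2 * v + f3 * w)\<bar> \<le> \<bar>a1\<bar> * (\<bar>f1\<bar> + \<bar>f2\<bar> + \<bar>f3\<bar>)"
    unfolding abs_mult[of "a1 * u"] by (rule mult_mono[OF a1 abs_lincomb_le[OF u]]) auto
  have 6: "\<bar>(a2 * v + a3 * w) * (g1 * u + g2 * v + g3 * w)\<bar> \<le> (\<bar>a2\<bar> + \<bar>a3\<bar>) * (\<bar>g1\<bar> + \<bar>g2\<bar> + \<bar>g3\<bar>)"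
    unfolding abs_mult[of "a2 * v + a3 * w"] by (rule mult_mono[OF a2 abs_lincomb_le[OF u]]) auto
  have "\<bar>D\<bar> * \<bar>x - (h0 + h1 * u + h2 * v + h3 * w)\<bar> \<le> \<bar>?r0\<bar> + (\<bar>?r1\<bar> + \<bar>?r2\<bar> + \<bar>?r3\<bar>)
      + \<bar>a1\<bar> * (\<bar>f1\<bar> + \<bar>f2\<bar> + \<bar>f3\<bar>) + (\<bar>a2\<bar> + \<bar>a3\<bar>) * (\<bar>g1\<bar> + \<bar>g2\<bar> + \<bar>g3\<bar>)
      + (\<bar>P\<bar> + \<bar>a1\<bar>) * fe + (\<bar>Q\<bar> + (\<bar>a2\<bar> + \<bar>a3\<bar>)) * ge + R * pe"
    unfolding abs_mult[symmetric, of D] eq by (rule abs_sum7_le[OF order_refl 4 5 6 1 2 3])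
  also have "\<dots> \<le> \<bar>D\<bar> * he"
    using ok by (simp only: add.assoc)
  finally have "\<bar>D\<bar> * \<bar>x - (h0 + h1 * u + h2 * v + h3 * w)\<bar> \<le> \<bar>D\<bar> * he" .
  then show ?thesis using \<open>D \<noteq> 0\<close> by simp
qed

text \<open>\<open>g\<close> and \<open>f\<close> are the two preceding entries, and
  \<open>ps\<close> is the previous row from index \<open>n + 1\<close> on. Each row therefore ends
  before its predecessor: 18 entries in row 0 are needed to reach index 13 in row 4.\<close>

fun check_row :: "int \<Rightarrow> int \<Rightarrow> taylor \<Rightarrow> taylor \<Rightarrow> taylor list \<Rightarrow> taylor list \<Rightarrow> bool" where
  "check_row m n g f ps [] \<longleftrightarrow> True"
| "check_row m n g f [] (h # hs) \<longleftrightarrow> False"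
| "check_row m n g f (p # ps) (h # hs) \<longleftrightarrow>
    (if m = 1 \<and> n = 1 then h = (10^25,0,0,0,0) else step_ok m n g f p h)
    \<and> check_row m (n + 1) f h ps hs"

declare encl.simps [simp del]

context
  fixes u v w b c d :: real
  assumes u: "\<bar>u\<bar> \<le> 1" "\<bar>v\<bar> \<le> 1" "\<bar>w\<bar> \<le> 1"
    and b: "10^14 * b = - 51061028256798 + 100 * u"
    and c: "10^14 * c = 95062762376333 + 100 * v"
    and d: "10^14 * d = - 31564554952688 + 100 * w"
begin

lemma encl_integral_coeff:
  assumes ok: "step_ok (3 * int k + 1) (int n) g f p h" and "\<not> (k = 0 \<and> n = 1)"
    and G: "encl u v w g (if n < 2 then 0 else integral_coeff b c d k (n - 2))"
    and F: "encl u v w f (if n = 0 then 0 else integral_coeff b c d k (n - 1))"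
    and P: "encl u v w p (if k = 0 then 0 else integral_coeff b c d (k - 1) (n + 1))"
  shows "encl u v w h (integral_coeff b c d k n)"
proof -
  obtain g0 g1 g2 g3 ge where g: "g = (g0,g1,g2,g3,ge)" by (cases g)
  obtain f0 f1 f2 f3 fe where f: "f = (f0,f1,f2,f3,fe)" by (cases f)
  obtain p0 p1 p2 p3 pe where p: "p = (p0,p1,p2,p3,pe)" by (cases p)
  obtain h0 h1 h2 h3 he where h: "h = (h0,h1,h2,h3,he)" by (cases h)
  define m where "m = 3 * k + 1"
  define \<delta> where "\<delta> = (if n = m then 1 else int n - int m)"
  define xg where "xg = (if n < 2 then 0 else integral_coeff b c d k (n - 2))"
  define xf where "xf = (if n = 0 then 0 else integral_coeff b c d k (n - 1))"
  define xp where "xp = (if k = 0 then 0 else integral_coeff b c d (k - 1) (n + 1))"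
  have \<delta>: "\<delta> \<noteq> 0" by (auto simp: \<delta>_def)
  have integral_coeff: "\<delta> * integral_coeff b c d k n = (m + (real n - 1) * b) * xf + (m * c + (real n - 2) * d) * xg + (real n + 1) * xp"
    using assms(2) by (subst integral_coeff.simps) (auto simp: \<delta>_def m_def xg_def xf_def xp_def)
  define P Q R D a1 a2 a3 where
    "P = 10^14 * int m + (int n - 1) * (- 51061028256798)" and
    "Q = int m * 95062762376333 + (int n - 2) * (- 31564554952688)" and
    "R = 10^14 * (int n + 1)" and "D = 10^14 * \<delta>" and
    "a1 = 100 * (int n - 1)" and "a2 = 100 * int m" and "a3 = 100 * (int n - 2)"
  note defs = P_def Q_def R_def D_def a1_def a2_def a3_def
  have "\<bar>P*f0 + Q*g0 + R*p0 - D*h0\<bar> + \<bar>P*f1 + Q*g1 + R*p1 + a1*f0 - D*h1\<bar>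
        + \<bar>P*f2 + Q*g2 + R*p2 + a2*g0 - D*h2\<bar> + \<bar>P*f3 + Q*g3 + R*p3 + a3*g0 - D*h3\<bar>
        + \<bar>a1\<bar> * (\<bar>f1\<bar> + \<bar>f2\<bar> + \<bar>f3\<bar>) + (\<bar>a2\<bar> + \<bar>a3\<bar>) * (\<bar>g1\<bar> + \<bar>g2\<bar> + \<bar>g3\<bar>)
        + (\<bar>P\<bar> + \<bar>a1\<bar>) * fe + (\<bar>Q\<bar> + (\<bar>a2\<bar> + \<bar>a3\<bar>)) * ge + R * pe \<le> \<bar>D\<bar> * he"
    (is "?L \<le> ?R")
  proof -
    have m: "3 * int k + 1 = int m" by (simp add: m_def)
    have "int n = int m \<longleftrightarrow> n = m" by simp
    then have D: "D = 10^14 * (if int n = int m then 1 else int n - int m)"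
      by (simp only: D_def \<delta>_def)
    show ?thesis
      using ok unfolding g f p h m step_ok_def prod.case Let_def P_def Q_def R_def D a1_def a2_def a3_def .
  qed
  then have "real_of_int ?L \<le> real_of_int ?R"
    by (simp only: of_int_le_iff)
  note ok' = this[unfolded of_int_add of_int_diff of_int_mult of_int_abs]
  \<comment> \<open>The recursion in the two scales of the table: 10^14 for parameters, 10^25 for
    values.\<close>
  have x: "real_of_int D * (10^25 * integral_coeff b c d k n) =
      (P + a1 * u) * (10^25 * xf) + (Q + a2 * v + a3 * w) * (10^25 * xg) + R * (10^25 * xp)"
  proof -
    have "10^14 * (m + (real n - 1) * b) = 10^14 * real m + (real n - 1) * (10^14 * b)"
      by (simp only: distrib_left mult.left_commute)
    also have "\<dots> = P + a1 * u"
      unfolding b by (simp add: P_def a1_def algebra_simps)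
    finally have *: "10^14 * (m + (real n - 1) * b) = P + a1 * u" .
    have "10^14 * (m * c + (real n - 2) * d) = m * (10^14 * c) + (real n - 2) * (10^14 * d)"
      by (simp only: distrib_left mult.left_commute)
    also have "\<dots> = Q + a2 * v + a3 * w"
      unfolding c d by (simp add: Q_def a2_def a3_def algebra_simps)
    finally have **: "10^14 * (m * c + (real n - 2) * d) = Q + a2 * v + a3 * w" .
    have R: "real_of_int R = 10^14 * (real n + 1)"
      by (simp add: R_def)
    have "real_of_int D * (10^25 * integral_coeff b c d k n) = 10^25 * (10^14 * (\<delta> * integral_coeff b c d k n))"
      by (simp add: D_def)
    also have "\<dots> = (10^14 * (m + (real n - 1) * b)) * (10^25 * xf)
        + (10^14 * (m * c + (real n - 2) * d)) * (10^25 * xg) + R * (10^25 * xp)"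
      unfolding integral_coeff R by (simp only: distrib_left distrib_right mult_ac)
    finally show ?thesis unfolding * ** .
  qed
  have F': "\<bar>10^25 * xf - (f0 + f1 * u + f2 * v + f3 * w)\<bar> \<le> fe"
    using F unfolding f encl.simps xf_def .
  have G': "\<bar>10^25 * xg - (g0 + g1 * u + g2 * v + g3 * w)\<bar> \<le> ge"
    using G unfolding g encl.simps xg_def .
  have P': "\<bar>10^25 * xp - (p0 + p1 * u + p2 * v + p3 * w)\<bar> \<le> pe"
    using P unfolding p encl.simps xp_def .
  have R: "real_of_int R \<ge> 0" by (simp add: R_def)
  have D: "real_of_int D \<noteq> 0" using \<delta> by (simp add: D_def)
  show ?thesis unfolding h encl.simps
    by (rule step_bound[OF u R D F' G' P' x ok'])
qed

text \<open>The start \<open>n\<close> and the window \<open>g\<close>, \<open>f\<close> are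
  arbitrary for the sake of the induction. Negative indices and the row before row 0 count as 0, as
  in the recursion.\<close>

lemma encl_row:
  assumes "check_row (3 * int k + 1) (int n) g f ps hs"
    and "encl u v w g (if n < 2 then 0 else integral_coeff b c d k (n - 2))"
    and "encl u v w f (if n = 0 then 0 else integral_coeff b c d k (n - 1))"
    and "\<And>i. i < length ps \<Longrightarrow> encl u v w (ps ! i) (if k = 0 then 0 else integral_coeff b c d (k - 1) (n + 1 + i))"
    and "i < length hs"
  shows "encl u v w (hs ! i) (integral_coeff b c d k (n + i))"
  using assms
proof (induction hs arbitrary: n g f ps i)
  case Nil
  from Nil.prems(5) show ?case by simp
next
  case (Cons h hs)
  obtain p ps' where ps: "ps = p # ps'"
    using Cons.prems(1) by (cases ps) auto
  have h: "encl u v w h (integral_coeff b c d k n)"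
  proof (cases "k = 0 \<and> n = 1")
    case True
    then have "h = (10^25,0,0,0,0)" using Cons.prems(1) ps by simp
    then show ?thesis using True by (simp add: integral_coeff.simps encl.simps)
  next
    case False
    then have "\<not> (3 * int k + 1 = 1 \<and> int n = 1)" by auto
    then have "step_ok (3 * int k + 1) (int n) g f p h"
      using Cons.prems(1) unfolding ps check_row.simps by presburger
    then show ?thesis
      by (rule encl_integral_coeff[OF _ False Cons.prems(2,3)]) (use Cons.prems(4)[of 0] ps in \<open>simp split: if_splits\<close>)
  qed
  show ?case
  proof (cases i)
    case 0
    then show ?thesis using h by simp
  next
    case (Suc j)
    have n1: "int (Suc n) = int n + 1" by simp
    have row: "check_row (3 * int k + 1) (int n + 1) f h ps' hs"
      using Cons.prems(1) unfolding ps check_row.simps by (rule conjunct2)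
    have "encl u v w (hs ! j) (integral_coeff b c d k (Suc n + j))"
    proof (rule Cons.IH)
      show "check_row (3 * int k + 1) (int (Suc n)) f h ps' hs"
        unfolding n1 by (rule row)
      show "encl u v w f (if Suc n < 2 then 0 else integral_coeff b c d k (Suc n - 2))"
        using Cons.prems(3) by (cases n) (auto simp: numeral_2_eq_2)
      show "encl u v w h (if Suc n = 0 then 0 else integral_coeff b c d k (Suc n - 1))"
        using h by simp
      show "encl u v w (ps' ! l) (if k = 0 then 0 else integral_coeff b c d (k - 1) (Suc n + 1 + l))"
        if "l < length ps'" for l
        using Cons.prems(4)[of "Suc l"] that ps by (cases "k = 0") simp_all
      show "j < length hs" using Cons.prems(5) Suc by simp
    qed
    then show ?thesis unfolding Suc nth_Cons_Suc add_Suc add_Suc_right .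
  qed
qed
end

text \<open>
  Row \<open>k\<close> encloses the coefficients for \<open>n = 0, 1, \<dots>\<close>; it was computed outside by the rounded
  recursion and is only checked here. Where the linear part is no longer needed, it has been moved
  into the error bound.
\<close>

definition row0 :: "taylor list" where
  "row0 = [
    (0, 0, 0, 0, 0),
    (10000000000000000000000000, 0, 0, 0, 0),
    (4893897174320200000000000, 10000000000000, 0, 0, 0),
    (3122984739304073802633213, 4787794348640, 5000000000000, 5000000000000, 11),
    (- 32699835112385429807819, 3338674245980, 744914311934, 2376213370040, 29),
    (11403628060737854858823, - 898374766230, 591227574482, 1727586635648, 31),
    (- 1501911505524051866345, 82145127396, - 236657216415, - 711020167230, 23),
    (- 676246856609386845396, 64214815444, 21454926923, 73348272925, 17),
    (451073551796566750390, - 35360451996, 23784738113, 67548117683, 12),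
    (- 67523445727708571840, 3981493995, - 12632347841, - 38181151871, 10),
    (- 51939094309433732855, 4528132109, 935626804, 3836848895, 8),
    (34089888534081096202, - 2663811656, 1996813726, 5580713120, 7),
    (- 3892230309590710363, 244069359, - 1030407898, - 3158851872, 6),
    (- 5500002029652869021, 451550083, 23534306, 208318672, 6),
    (3234720545829558061, - 254597173, 214370208, 595449612, 6),
    (- 182043585840144241, 13361208, - 99840198, - 313530561, 5),
    (- 667138733153103008, 52756160, - 5029186, 4524735, 4),
    (342005667095704264, - 27467689, 25854806, 71952821, 5)]"

definition row1 :: "taylor list" where
  "row1 = [
    (- 2500000000000000000000000, 0, 0, 0, 0),
    (70735217119866666666667, - 6666666666667, 0, 0, 1),
    (- 54750359778652769738749, 4414239926587, - 2500000000000, - 7500000000000, 23),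
    (47244437220135092044762, - 3148477074725, 4184350470945, 12765257064200, 252),
    (- 3310151270, 1877408761751, 5136772698078, 16251100695674, 998),
    (125898510283987423000990, - 4822699852757, 20773291176596, 64140232833971, 3050),
    (88717471792351403234435, - 565359419905, 21627551568964, 67298843851584, 3860),
    (122237346630179591917206, - 3668998181467, 22383416695272, 68950125384640, 3950),
    (55190404888153959354702, - 437391621312, 12762393974068, 39497937928124, 2680),
    (37903799005972516347747, - 1064150422238, 7014320132307, 21475665909733, 1620),
    (8050134581232940386661, 64470903814, 2061290898561, 6361141516744, 895),
    (3928731564844735557654, - 144467902340, 657846591155, 1988615866370, 443),
    (- 152787768864122507915, 40537637435, 37583071024, 122229428918, 192),
    (185378346525222257496, - 15485337574, 17347054847, 49843143753, 77),
    (- 49400217985506979544, 4405812371, - 4731426143, - 13621473578, 29),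
    (8098872316082586341, - 823649500, 939885376, 2761203209, 18),
    (552970947429467525, - 3992519, - 23350152, - 97838715, 15)]"

definition row2 :: "taylor list" where
  "row2 = [
    (- 10105031017123809523810, 952380952381, 0, 0, 1),
    (30039322779528701024028, - 2582524419973, 833333333333, 2500000000000, 10),
    (- 53885466531491641239763, 3967376365126, - 3578028192048, - 10903849097236, 169),
    (32939406862292092417972, - 3687990326786, - 1161853631783, - 3922400726025, 1290),
    (- 161684374759823139832376, 6761774134038, - 25195071904170, - 77823348121351, 7840),
    (40627368228792448798671, - 4216977074585, 770698122956, 2154440397179, 35000),
    (- 164557626597083576197742, 7774321380043, - 23132311095184, - 71976028323594, 227000),
    (- 12508838611, 4709806269502, 15239132446584, 43800939235283, 1100000),
    (- 442245692898669170878338, 43566974469562, 4060269642998, - 299574977183, 4870000),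
    (- 604348459377358910571962, 72522050752713, 50092552281180, 128713898790515, 9550000),
    (- 1078692685650028537146245, 115749847294713, 47118097061157, 108864441586438, 14400000),
    (- 1087374936871578713073048, 121371680972683, 69122378848808, 173266716436399, 16000000),
    (- 1054988314895166226851411, 112123039209733, 50621383924987, 122067932934858, 14600000),
    (- 730283356778878306104720, 0, 0, 0, 229000000000000),
    (- 469795482386716805069567, 0, 0, 0, 125000000000000),
    (- 224144951116589650300916, 0, 0, 0, 78000000000000)]"

definition row3 :: "taylor list" where
  "row3 = [
    (- 3003932277952870102403, 258252441997, - 83333333333, - 250000000000, 2),
    (15312250649167998167062, - 1168586350025, 887709968603, 2700855354941, 41),
    (- 26945740551808726727414, 2460351371363, - 514504492941, - 1435712224496, 538),
    (106849731348976272671701, - 5477730254363, 13869738998710, 42763779931598, 5240),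
    (- 144802565523193648545179, 7552516781157, - 19411518236659, - 60017884650241, 37400),
    (245011512721207772024870, - 11856112298902, 34695572455028, 108620351308459, 342000),
    (- 157720023046369208618769, - 2040620072211, - 50894857139961, - 155037114535528, 2640000),
    (896500608995106167209138, - 79813070412551, 14341164667909, 71804668755299, 20000000),
    (439547708312082718119539, - 65291427862791, - 76988016914030, - 219335527268446, 118000000),
    (1645402965054323069851100, - 192431760001203, - 129396791413118, - 321465699333386, 988000000),
    (384649055890, - 145908524679653, - 472046236195436, - 1359119353371639, 6340000000),
    (- 1692481778592391588382939, 0, 0, 0, 10600000000000000),
    (- 8456158416378244325999056, 0, 0, 0, 31100000000000000),
    (- 16512611739596803261781782, 0, 0, 0, 62100000000000000),
    (- 26808865683381548368417173, 0, 0, 0, 97100000000000000)]"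

definition row4 :: "taylor list" where
  "row4 = [
    (- 1177865434551384474389, 0, 0, 0, 366000000000),
    (5766977646065454301824, 0, 0, 0, 1140000000000),
    (- 34365361537388357895513, 0, 0, 0, 18700000000000),
    (92141644164903070075340, 0, 0, 0, 58600000000000),
    (- 208750607333268911130264, 0, 0, 0, 186000000000000),
    (272783550974569674809680, 0, 0, 0, 495000000000000),
    (- 972721653796321609436996, 0, 0, 0, 1200000000000000),
    (534720300971902238639972, 0, 0, 0, 3360000000000000),
    (- 1933983481938084482617020, 0, 0, 0, 10100000000000000),
    (2953751618039907227766133, 0, 0, 0, 36000000000000000),
    (4269773805755551996285984, 0, 0, 0, 173000000000000000),
    (19828430063050522407676101, 0, 0, 0, 1050000000000000000),
    (28975771788303727920675535, 0, 0, 0, 10200000000000000000),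
    (13570295954378744852404, 0, 0, 0, 80800000000000000000)]"

abbreviation zero_taylor :: taylor where "zero_taylor \<equiv> (0,0,0,0,0)"

text \<open>Zeros stand for the missing predecessor of row 0. The later checks drop the head of the
  previous row, because entry \<open>n\<close> needs entry \<open>n + 1\<close> there.\<close>

lemma check_row0: "check_row 1 0 zero_taylor zero_taylor (replicate 18 zero_taylor) row0"
  by code_simp

lemma check_row1: "check_row 4 0 zero_taylor zero_taylor (tl row0) row1"
  by code_simp

lemma check_row2: "check_row 7 0 zero_taylor zero_taylor (tl row1) row2"
  by code_simp

lemma check_row3: "check_row 10 0 zero_taylor zero_taylor (tl row2) row3"
  by code_simp

lemma check_row4: "check_row 13 0 zero_taylor zero_taylor (tl row3) row4"
  by code_simp


lemma encl_rows:
  assumes u: "\<bar>u\<bar> \<le> 1" "\<bar>v\<bar> \<le> 1" "\<bar>w\<bar> \<le> 1"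
    and b: "10^14 * b = - 51061028256798 + 100 * u"
    and c: "10^14 * c = 95062762376333 + 100 * v"
    and d: "10^14 * d = - 31564554952688 + 100 * w"
  shows "encl u v w (row1 ! 4) (integral_coeff b c d 1 4)" "encl u v w (row2 ! 7) (integral_coeff b c d 2 7)"
    "encl u v w (row3 ! 10) (integral_coeff b c d 3 10)" "encl u v w (row4 ! 13) (integral_coeff b c d 4 13)"
proof -
  have z: "encl u v w zero_taylor 0" by (simp add: encl.simps)
  have r0: "encl u v w (row0 ! i) (integral_coeff b c d 0 i)" if "i < length row0" for i
  proof -
    have "encl u v w (row0 ! i) (integral_coeff b c d 0 (0 + i))"
      by (rule encl_row[where k = 0 and n = 0 and g = zero_taylor and f = zero_taylor and ps = "replicate 18 zero_taylor", OF u b c d])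
         (use check_row0 z that in simp_all)
    then show ?thesis by simp
  qed
  have step: "encl u v w (s ! i) (integral_coeff b c d (Suc k) i)"
    if "check_row (3 * int (Suc k) + 1) 0 zero_taylor zero_taylor (tl r) s" "i < length s"
      and r: "\<And>i. i < length r \<Longrightarrow> encl u v w (r ! i) (integral_coeff b c d k i)" for k r s i
  proof -
    have "encl u v w (tl r ! j) (integral_coeff b c d k (Suc j))" if "j < length (tl r)" for j
      using r[of "Suc j"] that by (simp add: nth_tl)
    then have "encl u v w (s ! i) (integral_coeff b c d (Suc k) (0 + i))"
      by (intro encl_row[where k = "Suc k" and n = 0 and g = zero_taylor and f = zero_taylor and ps = "tl r", OF u b c d])
         (use that z in simp_all)
    then show ?thesis by simp
  qed
  have r1: "encl u v w (row1 ! i) (integral_coeff b c d (Suc 0) i)" if "i < length row1" for i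
    by (rule step[OF _ that r0]) (simp_all add: check_row1)
  have r2: "encl u v w (row2 ! i) (integral_coeff b c d (Suc (Suc 0)) i)" if "i < length row2" for i
    by (rule step[OF _ that r1]) (simp_all add: check_row2)
  have r3: "encl u v w (row3 ! i) (integral_coeff b c d (Suc (Suc (Suc 0))) i)" if "i < length row3" for i
    by (rule step[OF _ that r2]) (simp_all add: check_row3)
  have r4: "encl u v w (row4 ! i) (integral_coeff b c d (Suc (Suc (Suc (Suc 0)))) i)" if "i < length row4" for i
    by (rule step[OF _ that r3]) (simp_all add: check_row4)
  have "length row1 = 17" "length row2 = 16" "length row3 = 15" "length row4 = 14"
    by (simp_all add: row1_def row2_def row3_def row4_def)
  then show "encl u v w (row1 ! 4) (integral_coeff b c d 1 4)" "encl u v w (row2 ! 7) (integral_coeff b c d 2 7)"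
    "encl u v w (row3 ! 10) (integral_coeff b c d 3 10)" "encl u v w (row4 ! 13) (integral_coeff b c d 4 13)"
    using r1[of 4] r2[of 7] r3[of 10] r4[of 13] by (simp_all add: eval_nat_numeral)
qed

section \<open>Brouwer's theorem for the Newton map\<close>

lemma continuous_on_integral_coeff:
  fixes B C D :: "'a::topological_space \<Rightarrow> real"
  assumes "continuous_on S B" "continuous_on S C" "continuous_on S D"
  shows "continuous_on S (\<lambda>x. integral_coeff (B x) (C x) (D x) k n)"
\<comment> \<open>Only \<open>k\<close> and \<open>n\<close> drive the recursion, so the parameters
  are given dummy values. All denominators are nonzero constants.\<close>
proof (induction "0::real" "0::real" "0::real" k n rule: integral_coeff.induct)
  case (1 k n)
  show ?case
  proof (cases "k = 0 \<and> n = 1")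
    case True
    then show ?thesis by (simp add: integral_coeff.simps)
  next
    case False
    have A: "continuous_on S (\<lambda>x. if n = 0 then 0 else integral_coeff (B x) (C x) (D x) k (n - 1))"
      using 1(1)[OF False] by (cases "n = 0") simp_all
    have B: "continuous_on S (\<lambda>x. if n < 2 then 0 else integral_coeff (B x) (C x) (D x) k (n - 2))"
      using 1(2)[OF False] by (cases "n < 2") simp_all
    have C: "continuous_on S (\<lambda>x. if k = 0 then 0 else integral_coeff (B x) (C x) (D x) (k - 1) (n + 1))"
      using 1(3)[OF False] by (cases "k = 0") simp_all
    have eq: "integral_coeff (B x) (C x) (D x) k n =
     ((real (3*k+1) + (real n - 1) * B x) * (if n = 0 then 0 else integral_coeff (B x) (C x) (D x) k (n - 1))
    + (real (3*k+1) * C x + (real n - 2) * D x) * (if n < 2 then 0 else integral_coeff (B x) (C x) (D x) k (n - 2))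
    + (real n + 1) * (if k = 0 then 0 else integral_coeff (B x) (C x) (D x) (k - 1) (n + 1)))
     / (if n = 3*k+1 then 1 else real n - real (3*k+1))" for x
      using False by (subst integral_coeff.simps) (simp only: if_False)
    show ?thesis
      unfolding eq by (intro continuous_intros assms A B C) simp
  qed
qed

text \<open>One component of the Newton map in scale \<open>K\<close>: \<open>c0\<close> is its
  value at the centre, \<open>c1\<close>, \<open>c2\<close>, \<open>c3\<close> are the slopes left
  over because the inverse is only approximate, and the \<open>r\<close> terms are enclosure
  errors.\<close>

lemma affine_bound:
  fixes u v w :: real
  assumes u: "\<bar>u\<bar> \<le> 1" "\<bar>v\<bar> \<le> 1" "\<bar>w\<bar> \<le> 1"
    and r: "\<bar>r1\<bar> \<le> e1" "\<bar>r2\<bar> \<le> e2" "\<bar>r3\<bar> \<le> e3"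
    and t: "K * t = c0 + c1 * u + c2 * v + c3 * w + d1 * r1 + d2 * r2 + d3 * r3" and "K > 0"
    and le: "\<bar>c0\<bar> + \<bar>c1\<bar> + \<bar>c2\<bar> + \<bar>c3\<bar> + \<bar>d1\<bar> * e1 + \<bar>d2\<bar> * e2 + \<bar>d3\<bar> * e3 \<le> K"
  shows "t \<in> {-1..1}"
proof -
  have "\<bar>K * t\<bar> \<le> K"
    unfolding t
    by (rule order_trans[OF abs_sum7_le le])
       (use u r in \<open>simp_all add: abs_mult mult_left_le mult_left_mono\<close>)
  then have "\<bar>t\<bar> \<le> 1" using \<open>K > 0\<close> by (simp add: abs_mult)
  then show ?thesis by auto
qed

lemma exists_obstruction_zero:
  "\<exists>b c d. integral_coeff b c d 1 4 = 0 \<and> integral_coeff b c d 2 7 = 0 \<and> integral_coeff b c d 3 10 = 0 \<and> integral_coeff b c d 4 13 \<noteq> 0"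
proof -
  define B C D :: "real \<times> real \<times> real \<Rightarrow> real" where
    "B = (\<lambda>x. (- 51061028256798 + 100 * fst x) / 10^14)" and
    "C = (\<lambda>x. (95062762376333 + 100 * fst (snd x)) / 10^14)" and
    "D = (\<lambda>x. (- 31564554952688 + 100 * snd (snd x)) / 10^14)"
  define V where "V = (\<lambda>k x. integral_coeff (B x) (C x) (D x) k (3 * k + 1))"
  \<comment> \<open>The matrix is an approximate inverse of the Jacobian of \<open>(V 1, V 2, V 3)\<close> with respect to the offsets.\<close>
  define T :: "real \<times> real \<times> real \<Rightarrow> real \<times> real \<times> real" where
    "T = (\<lambda>x. (fst x - 10000000000 * (3591 * V 1 x + 69322 * V 2 x + 2277 * V 3 x),
               fst (snd x) - 10000000000 * (- 1031 * V 1 x + 18135 * V 2 x + 572 * V 3 x),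
               snd (snd x) - 10000000000 * (- 27 * V 1 x - 13741 * V 2 x - 444 * V 3 x)))"
  define S :: "(real \<times> real \<times> real) set" where "S = {-1..1} \<times> {-1..1} \<times> {-1..1}"
  have bounds: "\<bar>10000000000000000000000000 * V 1 x - (- 3310151270 + 1877408761751 * fst x + 5136772698078 * fst (snd x) + 16251100695674 * snd (snd x))\<bar> \<le> 998"
    "\<bar>10000000000000000000000000 * V 2 x - (- 12508838611 + 4709806269502 * fst x + 15239132446584 * fst (snd x) + 43800939235283 * snd (snd x))\<bar> \<le> 1100000"
    "\<bar>10000000000000000000000000 * V 3 x - (384649055890 - 145908524679653 * fst x - 472046236195436 * fst (snd x) - 1359119353371639 * snd (snd x))\<bar> \<le> 6340000000"
    "\<bar>10000000000000000000000000 * V 4 x - 13570295954378744852404\<bar> \<le> 80800000000000000000"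
    if "x \<in> S" for x
  proof -
    have u: "\<bar>fst x\<bar> \<le> 1" "\<bar>fst (snd x)\<bar> \<le> 1" "\<bar>snd (snd x)\<bar> \<le> 1"
      using that by (auto simp: S_def)
    have "10^14 * B x = - 51061028256798 + 100 * fst x"
      "10^14 * C x = 95062762376333 + 100 * fst (snd x)"
      "10^14 * D x = - 31564554952688 + 100 * snd (snd x)"
      by (simp_all add: B_def C_def D_def)
    note e = encl_rows[OF u this]
    show "\<bar>10000000000000000000000000 * V 1 x - (- 3310151270 + 1877408761751 * fst x + 5136772698078 * fst (snd x) + 16251100695674 * snd (snd x))\<bar> \<le> 998"
      using e(1) by (simp add: V_def row1_def encl.simps)
    show "\<bar>10000000000000000000000000 * V 2 x - (- 12508838611 + 4709806269502 * fst x + 15239132446584 * fst (snd x) + 43800939235283 * snd (snd x))\<bar> \<le> 1100000"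
      using e(2) by (simp add: V_def row2_def encl.simps)
    show "\<bar>10000000000000000000000000 * V 3 x - (384649055890 - 145908524679653 * fst x - 472046236195436 * fst (snd x) - 1359119353371639 * snd (snd x))\<bar> \<le> 6340000000"
      using e(3) by (simp add: V_def row3_def encl.simps)
    show "\<bar>10000000000000000000000000 * V 4 x - 13570295954378744852404\<bar> \<le> 80800000000000000000"
      using e(4) by (simp add: V_def row4_def encl.simps)
  qed
  have cont: "continuous_on S (V k)" for k
    unfolding V_def by (intro continuous_on_integral_coeff) (auto simp: B_def C_def D_def intro!: continuous_intros)
  have "T \<in> S \<rightarrow> S"
  proof
    fix x assume x: "x \<in> S"
    define u v w where uvw: "u = fst x" "v = fst (snd x)" "w = snd (snd x)"
    have u: "\<bar>u\<bar> \<le> 1" "\<bar>v\<bar> \<le> 1" "\<bar>w\<bar> \<le> 1"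
      using x by (auto simp: S_def uvw)
    define r1 r2 r3 where
      "r1 = 10000000000000000000000000 * V 1 x - (- 3310151270 + 1877408761751 * u + 5136772698078 * v + 16251100695674 * w)" and
      "r2 = 10000000000000000000000000 * V 2 x - (- 12508838611 + 4709806269502 * u + 15239132446584 * v + 43800939235283 * w)" and
      "r3 = 10000000000000000000000000 * V 3 x - (384649055890 - 145908524679653 * u - 472046236195436 * v - 1359119353371639 * w)"
    note r = bounds(1-3)[OF x, folded uvw, folded r1_def r2_def r3_def]
    \<comment> \<open>The scale is 10^15 = 10^25 / 10^10. In all three components the bounds add up
      to less than a quarter of it.\<close>
    have "1000000000000000 * (u - 10000000000 * (3591 * V 1 x + 69322 * V 2 x + 2277 * V 3 x)) =
        3178563140782 + (- 1254382295604) * u + (- 4010403886374) * v + (- 11644639231457) * w + (- 3591) * r1 + (- 69322) * r2 + (- 2277) * r3"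
      unfolding r1_def r2_def r3_def by (simp add: algebra_simps)
    from affine_bound[OF u r this]
    have T1: "u - 10000000000 * (3591 * V 1 x + 69322 * V 2 x + 2277 * V 3 x) \<in> {-1..1}" by simp
    have "1000000000000000 * (v - 10000000000 * ((- 1031) * V 1 x + 18135 * V 2 x + 572 * V 3 x)) =
        3415762282035 + (- 17052147291973) * u + (- 55207163293030) * v + (- 158878086039803) * w + 1031 * r1 + (- 18135) * r2 + (- 572) * r3"
      unfolding r1_def r2_def r3_def by (simp add: algebra_simps)
    from affine_bound[OF u r this]
    have T2: "v - 10000000000 * ((- 1031) * V 1 x + 18135 * V 2 x + 572 * V 3 x) \<in> {-1..1}" by simp
    have "1000000000000000 * (w - 10000000000 * ((- 27) * V 1 x + (- 13741) * V 2 x + (- 444) * V 3 x)) =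
        (- 1189144622881) + (- 15246971971673) * u + (- 48917059414734) * v + (- 141507146200815) * w + 27 * r1 + 13741 * r2 + 444 * r3"
      unfolding r1_def r2_def r3_def by (simp add: algebra_simps)
    from affine_bound[OF u r this]
    have T3: "w - 10000000000 * ((- 27) * V 1 x + (- 13741) * V 2 x + (- 444) * V 3 x) \<in> {-1..1}" by simp
    show "T x \<in> S"
      using T1 T2 T3 by (simp add: T_def S_def uvw)
  qed
  moreover have "continuous_on S T"
    unfolding T_def by (intro continuous_intros cont)
  moreover have "compact S" "convex S" "S \<noteq> {}"
    unfolding S_def by (auto intro!: compact_Times convex_Times)
  ultimately obtain x where x: "x \<in> S" "T x = x"
    by (metis brouwer)
  then have "3591 * V 1 x + 69322 * V 2 x + 2277 * V 3 x = 0"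
    "- 1031 * V 1 x + 18135 * V 2 x + 572 * V 3 x = 0"
    "- 27 * V 1 x - 13741 * V 2 x - 444 * V 3 x = 0"
    by (auto simp: T_def prod_eq_iff)
  \<comment> \<open>The integer matrix is invertible, so a fixed point is a zero.\<close>
  then have "V 1 x = 0" "V 2 x = 0" "V 3 x = 0"
    by linarith+
  \<comment> \<open>The error is below a hundredth of the central value, wherever in the cube the
    zero lies.\<close>
  moreover have "V 4 x \<noteq> 0"
    using bounds(4)[OF x(1)] by auto
  ultimately show ?thesis
    by (intro exI[of _ "B x"] exI[of _ "C x"] exI[of _ "D x"]) (simp add: V_def)
qed

section \<open>The truncated first integral\<close>

context
  fixes b c d :: real
begin

text \<open>z^(3k+1) w^n has degree 3k+1+n, and the derivation never lowers degrees; dropping terms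
  beyond degree 26 leaves a polynomial.\<close>

definition truncated_coeff :: "nat \<Rightarrow> nat \<Rightarrow> complex" where
  "truncated_coeff k n = (if 3*k+1+n \<le> 26 then of_real (integral_coeff b c d k n) else 0)"

text \<open>The four contributions of \<open>lie_monomial\<close> collected at one monomial, without
  the factor -i.\<close>

definition lie_coeff :: "nat \<Rightarrow> nat \<Rightarrow> complex" where
  "lie_coeff k n = truncated_coeff k n * (of_nat (3*k+1) - of_nat n)
    + (if n = 0 then 0 else truncated_coeff k (n - 1) * (of_nat (3*k+1) + (of_nat n - 1) * of_real b))
    + (if n < 2 then 0 else truncated_coeff k (n - 2) * (of_nat (3*k+1) * of_real c + (of_nat n - 2) * of_real d))
    + (if k = 0 then 0 else truncated_coeff (k - 1) (n + 1) * (of_nat n + 1))"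

abbreviation ZW :: "nat \<Rightarrow> nat \<Rightarrow> complex fps fps" where
  "ZW k n \<equiv> Z ^ (3*k+1) * W ^ n"

text \<open>The support lies in \<open>k \<le> 8\<close>, \<open>n \<le> 25\<close>, and the
  derivation reaches at most \<open>k + 1\<close> and \<open>n + 2\<close>, so the ranges lose
  nothing under the index shifts.\<close>

definition first_integral :: "complex fps fps" where
  "first_integral = (\<Sum>k\<le>9. \<Sum>n\<le>28. Const (truncated_coeff k n) * ZW k n)"

lemma lie_first_integral:
  "lie (P0 (of_real b) (of_real c) (of_real d)) (Q0 (of_real b) (of_real c) (of_real d)) first_integral
    = - (Const \<i> * (\<Sum>k\<le>9. \<Sum>n\<le>28. Const (lie_coeff k n) * ZW k n))"
  (is "?D first_integral = _")
proof -
  let ?f = truncated_coeff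
  define g1 where "g1 k n = Const (?f k n * (of_nat (3*k+1) - of_nat n)) * ZW k n" for k n
  define g2 where "g2 k n = (if n = 0 then 0 else
    Const (?f k (n - 1) * (of_nat (3*k+1) + (of_nat n - 1) * of_real b)) * ZW k n)" for k n
  define g3 where "g3 k n = (if n < 2 then 0 else
    Const (?f k (n - 2) * (of_nat (3*k+1) * of_real c + (of_nat n - 2) * of_real d)) * ZW k n)" for k n
  define g4 where "g4 k n = (if k = 0 then 0 else Const (?f (k - 1) (n + 1) * (of_nat n + 1)) * ZW k n)" for k n
  define h where "h k n = Const (?f k n * of_nat n) * (Z ^ (3*k+1+3) * W ^ (n - 1))" for k n
  have lie1: "?D (Const (?f k n) * ZW k n) = - (Const \<i> * (g1 k n + g2 k (Suc n) + g3 k (Suc (Suc n)) + h k n))" for k n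
  proof -
    have "?D (ZW k n) = - (Const \<i> *
     (Const (of_nat (Suc (3*k)) - of_nat n) * (Z ^ Suc (3*k) * W ^ n)
      + Const (of_nat (Suc (3*k)) + of_nat n * of_real b) * (Z ^ Suc (3*k) * W ^ Suc n)
      + Const (of_nat (Suc (3*k)) * of_real c + of_nat n * of_real d) * (Z ^ Suc (3*k) * W ^ Suc (Suc n))
      + Const (of_nat n) * (Z ^ (Suc (3*k) + 3) * W ^ (n - 1))))"
      unfolding Suc_eq_plus1[symmetric, of "3*k"] by (rule lie_monomial)
    moreover have "f * - (i * (a1 * m1 + a2 * m2 + a3 * m3 + a4 * m4))
        = - (i * (f * a1 * m1 + f * a2 * m2 + f * a3 * m3 + f * a4 * m4))"
      for f i a1 a2 a3 a4 m1 m2 m3 m4 :: "complex fps fps"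
      by (simp add: algebra_simps)
    ultimately show ?thesis
      unfolding lie_Const_mult g1_def g2_def g3_def h_def by (simp add: Const_mult)
  qed
  have 2: "(\<Sum>n\<le>28. g2 k (Suc n)) = (\<Sum>n\<le>28. g2 k n)" for k
    by (rule sum_atMost_shift) (simp_all add: g2_def truncated_coeff_def Const_0)
  have 3: "(\<Sum>n\<le>28. g3 k (Suc (Suc n))) = (\<Sum>n\<le>28. g3 k n)" for k
    by (subst sum_atMost_shift[where g = "\<lambda>n. g3 k (Suc n)"]; (subst sum_atMost_shift)?)
       (simp_all add: g3_def truncated_coeff_def Const_0)
  \<comment> \<open>The z^3 term shifts both indices: at \<open>n = 0\<close> it carries the factor
    0, and row 9 lies outside the truncation.\<close>
  have 4: "(\<Sum>k\<le>9. \<Sum>n\<le>28. h k n) = (\<Sum>k\<le>9. \<Sum>n\<le>28. g4 k n)"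
  proof -
    have "(\<Sum>n\<le>28. h k n) = (\<Sum>n\<le>28. h k (Suc n))" for k
      by (rule sum_atMost_shift[symmetric]) (simp_all add: h_def truncated_coeff_def Const_0)
    moreover have "h k (Suc n) = g4 (Suc k) n" for k n
    proof -
      have "3 * k + 1 + 3 = 3 * Suc k + 1" by simp
      then show ?thesis unfolding h_def g4_def by (simp add: add.commute del: power_Suc)
    qed
    moreover have "(\<Sum>k\<le>9. \<Sum>n\<le>28. g4 (Suc k) n) = (\<Sum>k\<le>9. \<Sum>n\<le>28. g4 k n)"
      by (rule sum_atMost_shift) (simp_all add: g4_def truncated_coeff_def Const_0)
    ultimately show ?thesis by simp
  qed
  have "?D first_integral = (\<Sum>k\<le>9. \<Sum>n\<le>28. - (Const \<i> * (g1 k n + g2 k (Suc n) + g3 k (Suc (Suc n)) + h k n)))"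
    unfolding first_integral_def lie_sum lie1 ..
  also have "\<dots> = - (Const \<i> * (\<Sum>k\<le>9. \<Sum>n\<le>28. g1 k n + g2 k (Suc n) + g3 k (Suc (Suc n)) + h k n))"
    by (simp only: sum_negf sum_distrib_left)
  also have "(\<Sum>k\<le>9. \<Sum>n\<le>28. g1 k n + g2 k (Suc n) + g3 k (Suc (Suc n)) + h k n)
    = (\<Sum>k\<le>9. \<Sum>n\<le>28. g1 k n + g2 k n + g3 k n + g4 k n)"
    by (simp only: sum.distrib 2 3 4)
  also have "\<dots> = (\<Sum>k\<le>9. \<Sum>n\<le>28. Const (lie_coeff k n) * ZW k n)"
    by (intro sum.cong refl) (simp add: g1_def g2_def g3_def g4_def lie_coeff_def Const_add Const_0 distrib_right)
  finally show ?thesis .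
qed

text \<open>Off resonance the recursion is exactly the condition for cancellation. At a resonance
  the diagonal factor is 0 and the stored numerator remains; for \<open>k = 0\<close>, where zw has
  the prescribed coefficient 1, the numerator is 0. The degree bound keeps every entry involved
  inside the truncation.\<close>

lemma lie_coeff_eq:
  assumes "3*k+1+n \<le> 26"
  shows "lie_coeff k n = (if n = 3*k+1 \<and> k \<noteq> 0 then of_real (integral_coeff b c d k n) else 0)"
proof (cases "k = 0 \<and> n = 1")
  case True
  then show ?thesis by (simp add: lie_coeff_def truncated_coeff_def integral_coeff.simps[of b c d 0 0])
next
  case False
  define T where "T = (real (3*k+1) + (real n - 1) * b) * (if n = 0 then 0 else integral_coeff b c d k (n - 1))
    + (real (3*k+1) * c + (real n - 2) * d) * (if n < 2 then 0 else integral_coeff b c d k (n - 2))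
    + (real n + 1) * (if k = 0 then 0 else integral_coeff b c d (k - 1) (n + 1))"
  have integral_coeff: "integral_coeff b c d k n = T / (if n = 3*k+1 then 1 else real n - real (3*k+1))"
    using False unfolding T_def by (subst integral_coeff.simps) (simp only: if_False)
  have "lie_coeff k n = of_real (integral_coeff b c d k n * (real (3*k+1) - real n) + T)"
    using assms by (auto simp: lie_coeff_def truncated_coeff_def T_def mult_ac)
  also have "integral_coeff b c d k n * (real (3*k+1) - real n) + T = (if n = 3*k+1 then integral_coeff b c d k n else 0)"
    unfolding integral_coeff by (auto simp: field_simps)
  finally show ?thesis using False by auto
qed

lemma vanishes_below_ZW: "vanishes_below (3*k+1+n) (ZW k n)"
  using vanishes_below_mult[OF vanishes_below_power[OF vanishes_below_Z, of "3*k+1"] vanishes_below_power[OF vanishes_below_W, of n]]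
  by simp

lemma sum_delta2:
  fixes A :: "'a::comm_monoid_add"
  assumes "i \<le> K" "j \<le> N"
  shows "(\<Sum>k\<le>(K::nat). \<Sum>n\<le>(N::nat). if k = i \<and> n = j then A else 0) = A"
proof -
  have "(\<Sum>k\<le>K. \<Sum>n\<le>N. if k = i \<and> n = j then A else 0) = (\<Sum>k\<le>K. if k = i then A else 0)"
    using assms by (intro sum.cong refl) auto
  then show ?thesis using assms by simp
qed

lemma first_integral_lowest: "vanishes_below 3 (first_integral - (X^2 + Y^2))"
proof -
  have "first_integral - (X^2 + Y^2) = (\<Sum>k\<le>9. \<Sum>n\<le>28.
      Const (truncated_coeff k n) * ZW k n - (if k = 0 \<and> n = 1 then ZW 0 1 else 0))"
    unfolding sum_subtractf first_integral_def by (subst sum_delta2) (simp_all add: Z_mult_W)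
  moreover have "vanishes_below 3 (Const (truncated_coeff k n) * ZW k n - (if k = 0 \<and> n = 1 then ZW 0 1 else 0))" for k n
  proof -
    consider "k = 0 \<and> n = 0" | "k = 0 \<and> n = 1" | "3 \<le> 3*k+1+n \<and> \<not> (k = 0 \<and> n = 1)" by linarith
    then show ?thesis
    proof cases
      case 3
      then have "vanishes_below 3 (Const (truncated_coeff k n) * ZW k n)"
        by (intro vanishes_below_mult_left vanishes_below_mono[OF vanishes_below_ZW]) simp
      moreover have "(if k = 0 \<and> n = 1 then ZW 0 1 else 0) = 0" using 3 by auto
      ultimately show ?thesis by (simp only: diff_zero)
    qed (auto simp: truncated_coeff_def integral_coeff.simps[of b c d 0 0] integral_coeff.simps[of b c d 0 "Suc 0"] Const_0 Const_1)
  qed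
  ultimately show ?thesis by (auto intro!: vanishes_below_sum)
qed

text \<open>The possible obstructions up to degree 26 are those with \<open>k = 1, 2, 3, 4\<close>;
  the hypotheses remove the first three.\<close>

lemma lie_first_integral_lowest:
  assumes "integral_coeff b c d 1 4 = 0" "integral_coeff b c d 2 7 = 0" "integral_coeff b c d 3 10 = 0"
  shows "vanishes_below 27 (lie (P0 (of_real b) (of_real c) (of_real d)) (Q0 (of_real b) (of_real c) (of_real d)) first_integral
    - Const (- \<i> * of_real (integral_coeff b c d 4 13)) * (X^2 + Y^2)^13)"
proof -
  define v where "v = complex_of_real (integral_coeff b c d 4 13)"
  have XY: "(X^2 + Y^2)^13 = ZW 4 13"
    by (simp add: power_mult_distrib flip: Z_mult_W)
  have "lie (P0 (of_real b) (of_real c) (of_real d)) (Q0 (of_real b) (of_real c) (of_real d)) first_integral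
      - Const (- \<i> * v) * (X^2 + Y^2)^13
    = - (Const \<i> * ((\<Sum>k\<le>9. \<Sum>n\<le>28. Const (lie_coeff k n) * ZW k n) - Const v * ZW 4 13))"
    unfolding lie_first_integral XY by (simp add: Const_mult Const_uminus right_diff_distrib mult.assoc)
  also have "(\<Sum>k\<le>9. \<Sum>n\<le>28. Const (lie_coeff k n) * ZW k n) - Const v * ZW 4 13
    = (\<Sum>k\<le>9. \<Sum>n\<le>28. Const (lie_coeff k n) * ZW k n - (if k = 4 \<and> n = 13 then Const v * ZW 4 13 else 0))"
    unfolding sum_subtractf by (subst sum_delta2) simp_all
  finally have eq: "lie (P0 (of_real b) (of_real c) (of_real d)) (Q0 (of_real b) (of_real c) (of_real d)) first_integral
      - Const (- \<i> * v) * (X^2 + Y^2)^13 = - (Const \<i> * \<dots>)" .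
  have vb: "vanishes_below 27 (Const (lie_coeff k n) * ZW k n - (if k = 4 \<and> n = 13 then Const v * ZW 4 13 else 0))" for k n
  proof (cases "3*k+1+n \<le> 26")
    case True
    show ?thesis
    proof (cases "n = 3*k+1 \<and> k \<noteq> 0")
      case n: True
      then consider "k = 1" | "k = 2" | "k = 3" | "k = 4" "n = 13" using True by linarith
      then show ?thesis
      proof cases
        case 4
        then have "lie_coeff k n = v" using n lie_coeff_eq[OF True] by (simp add: v_def)
        then show ?thesis by (simp only: 4 simp_thms if_True diff_self vanishes_below_zero)
      qed (use n assms lie_coeff_eq[OF True] in \<open>simp_all add: Const_0\<close>)
    qed (use lie_coeff_eq[OF True] in \<open>auto simp: Const_0\<close>)
  next
    case False
    then have "vanishes_below 27 (Const (lie_coeff k n) * ZW k n)"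
      by (intro vanishes_below_mult_left vanishes_below_mono[OF vanishes_below_ZW]) simp
    then show ?thesis using False by auto
  qed
  show ?thesis
    unfolding v_def[symmetric] eq
    by (intro vanishes_below_uminus vanishes_below_mult_left vanishes_below_sum vb)
qed
end

section \<open>Specialising the indeterminates\<close>

lemma UNIV_indet: "(UNIV :: indet set) = {P20, P11, P02, P30, P21, P12, P03, Q20, Q11, Q02, Q30, Q21, Q12, Q03}"
  by (auto intro: indet.exhaust)

lemma finite_indet [simp]: "finite (A :: indet set)"
  by (rule finite_subset[OF subset_UNIV]) (simp add: UNIV_indet)

definition monom_at :: "(indet \<Rightarrow> complex) \<Rightarrow> (indet \<Rightarrow>\<^sub>0 nat) \<Rightarrow> complex" where
  "monom_at \<phi> m = (\<Prod>v\<in>UNIV. \<phi> v ^ Poly_Mapping.lookup m v)"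

text \<open>With the coefficient map \<open>h\<close> as a parameter, one evaluation serves both
  rings: \<open>of_rat\<close> for the focal values, the identity for the ideal over the complex
  numbers.\<close>

definition eval_at :: "('k::comm_ring_1 \<Rightarrow> complex) \<Rightarrow> (indet \<Rightarrow> complex) \<Rightarrow> 'k coeff_poly \<Rightarrow> complex" where
  "eval_at h \<phi> f = (\<Sum>m\<in>Poly_Mapping.keys f. h (Poly_Mapping.lookup f m) * monom_at \<phi> m)"

lemma monom_at_zero: "monom_at \<phi> 0 = 1"
  by (simp add: monom_at_def)

lemma monom_at_add: "monom_at \<phi> (m + n) = monom_at \<phi> m * monom_at \<phi> n"
  by (simp add: monom_at_def Poly_Mapping.lookup_add power_add prod.distrib)

lemma monom_at_single: "monom_at \<phi> (Poly_Mapping.single v 1) = \<phi> v"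
proof -
  have "monom_at \<phi> (Poly_Mapping.single v 1) = (\<Prod>u\<in>UNIV. if u = v then \<phi> v else 1)"
    unfolding monom_at_def by (intro prod.cong refl) (simp add: Poly_Mapping.lookup_single when_def)
  then show ?thesis by (simp add: prod.delta)
qed

lemma poly_mapping_eq_sum_single:
  "f = (\<Sum>m\<in>Poly_Mapping.keys f. Poly_Mapping.single m (Poly_Mapping.lookup f m))"
proof (rule poly_mapping_eqI)
  fix k
  show "Poly_Mapping.lookup f k
      = Poly_Mapping.lookup (\<Sum>m\<in>Poly_Mapping.keys f. Poly_Mapping.single m (Poly_Mapping.lookup f m)) k"
    by (simp add: lookup_sum lookup_single when_def sum.delta in_keys_iff)
qed

context
  fixes h :: "'k::comm_ring_1 \<Rightarrow> complex"
  assumes h_add: "\<And>x y. h (x + y) = h x + h y" and h_mult: "\<And>x y. h (x * y) = h x * h y"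
    and h_one: "h 1 = 1"
begin

lemma h_zero: "h 0 = 0"
  using h_add[of 0 0] by simp

lemma eval_at_superset:
  assumes "finite A" "Poly_Mapping.keys f \<subseteq> A"
  shows "eval_at h \<phi> f = (\<Sum>m\<in>A. h (Poly_Mapping.lookup f m) * monom_at \<phi> m)"
  unfolding eval_at_def
  by (rule sum.mono_neutral_left) (use assms h_zero in \<open>auto simp: in_keys_iff\<close>)

lemma eval_at_add: "eval_at h \<phi> (f + g) = eval_at h \<phi> f + eval_at h \<phi> g"
proof -
  define A where "A = Poly_Mapping.keys f \<union> Poly_Mapping.keys g"
  have A: "finite A" "Poly_Mapping.keys f \<subseteq> A" "Poly_Mapping.keys g \<subseteq> A" "Poly_Mapping.keys (f + g) \<subseteq> A"
    using Poly_Mapping.keys_add[of f g] by (auto simp: A_def)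
  show ?thesis
    using A by (simp add: eval_at_superset[of A] Poly_Mapping.lookup_add h_add distrib_right sum.distrib)
qed

lemma eval_at_zero: "eval_at h \<phi> 0 = 0"
  by (simp add: eval_at_def)

lemma eval_at_diff: "eval_at h \<phi> (f - g) = eval_at h \<phi> f - eval_at h \<phi> g"
  using eval_at_add[of \<phi> "f - g" g] by simp

lemma eval_at_sum: "eval_at h \<phi> (sum f A) = (\<Sum>a\<in>A. eval_at h \<phi> (f a))"
  by (induction A rule: infinite_finite_induct) (simp_all add: eval_at_zero eval_at_add)

lemma eval_at_single: "eval_at h \<phi> (Poly_Mapping.single m a) = h a * monom_at \<phi> m"
  by (simp add: eval_at_superset[of "{m}"])

lemma eval_at_mult: "eval_at h \<phi> (f * g) = eval_at h \<phi> f * eval_at h \<phi> g"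
proof -
  have "f * g = (\<Sum>m\<in>Poly_Mapping.keys f. \<Sum>n\<in>Poly_Mapping.keys g.
      Poly_Mapping.single (m + n) (Poly_Mapping.lookup f m * Poly_Mapping.lookup g n))"
    by (subst (1) poly_mapping_eq_sum_single[of f], subst (1) poly_mapping_eq_sum_single[of g])
       (simp add: sum_product mult_single)
  then have "eval_at h \<phi> (f * g) = (\<Sum>m\<in>Poly_Mapping.keys f. \<Sum>n\<in>Poly_Mapping.keys g.
      (h (Poly_Mapping.lookup f m) * monom_at \<phi> m) * (h (Poly_Mapping.lookup g n) * monom_at \<phi> n))"
    by (simp add: eval_at_sum eval_at_single h_mult monom_at_add mult_ac)
  then show ?thesis by (simp add: eval_at_def sum_product)
qed

lemma eval_at_one: "eval_at h \<phi> 1 = 1"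
  using eval_at_single[of \<phi> 0 1] by (simp add: h_one monom_at_zero)

lemma eval_at_power: "eval_at h \<phi> (f ^ n) = eval_at h \<phi> f ^ n"
  by (induction n) (simp_all add: eval_at_one eval_at_mult)

lemma eval_at_of_nat: "eval_at h \<phi> (of_nat n) = of_nat n"
  by (induction n) (simp_all add: eval_at_zero eval_at_one eval_at_add)

lemma eval_at_Var: "eval_at h \<phi> (Var v) = \<phi> v"
  unfolding Var_def eval_at_single h_one by (simp only: monom_at_single mult_1)

end

lemma lookup_complex_poly: "Poly_Mapping.lookup (complex_poly f) m = of_rat (Poly_Mapping.lookup f m)"
  by (simp add: complex_poly_def Poly_Mapping.map.rep_eq when_def)

lemma eval_at_complex_poly: "eval_at (\<lambda>x. x) \<phi> (complex_poly f) = eval_at of_rat \<phi> f"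
proof -
  have "Poly_Mapping.keys (complex_poly f) = Poly_Mapping.keys f"
    by (auto simp: in_keys_iff lookup_complex_poly)
  then show ?thesis by (simp add: eval_at_def lookup_complex_poly)
qed

text \<open>The polynomials vanishing at \<open>\<phi>\<close> form an ideal.\<close>

lemma eval_at_ideal_generated:
  assumes "f \<in> ideal_generated A" "\<And>g. g \<in> A \<Longrightarrow> eval_at (\<lambda>x. x) \<phi> g = 0"
  shows "eval_at (\<lambda>x. x) \<phi> f = 0"
proof -
  interpret module "(*) :: complex coeff_poly \<Rightarrow> _"
    by unfold_locales (simp_all add: algebra_simps)
  have "span A \<subseteq> {f. eval_at (\<lambda>x. x) \<phi> f = 0}"
    by (rule span_minimal)
       (use assms(2) in \<open>auto simp: subspace_def eval_at_zero eval_at_add eval_at_mult\<close>)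
  then show ?thesis using assms(1) by (auto simp: ideal_generated_def)
qed

section \<open>Evaluation carried over to power series\<close>

definition eval_series :: "(indet \<Rightarrow> complex) \<Rightarrow> rat coeff_poly fps fps \<Rightarrow> complex fps fps" where
  "eval_series \<phi> F = Abs_fps (\<lambda>j. Abs_fps (\<lambda>i. eval_at of_rat \<phi> (coeff_xy F i j)))"

lemma coeff_eval_series: "coeff_xy (eval_series \<phi> F) i j = eval_at of_rat \<phi> (coeff_xy F i j)"
  by (simp add: eval_series_def)

lemmas eval_rat_simps =
  eval_at_zero[OF of_rat_add of_rat_mult of_rat_1] eval_at_one[OF of_rat_add of_rat_mult of_rat_1] eval_at_add[OF of_rat_add of_rat_mult of_rat_1]
  eval_at_diff[OF of_rat_add of_rat_mult of_rat_1] eval_at_mult[OF of_rat_add of_rat_mult of_rat_1]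
  eval_at_sum[OF of_rat_add of_rat_mult of_rat_1] eval_at_of_nat[OF of_rat_add of_rat_mult of_rat_1]
  eval_at_Var[OF of_rat_add of_rat_mult of_rat_1]

lemma eval_series_add: "eval_series \<phi> (F + G) = eval_series \<phi> F + eval_series \<phi> G"
  and eval_series_diff: "eval_series \<phi> (F - G) = eval_series \<phi> F - eval_series \<phi> G"
  and eval_series_mult: "eval_series \<phi> (F * G) = eval_series \<phi> F * eval_series \<phi> G"
  and eval_series_one: "eval_series \<phi> 1 = 1"
  and eval_series_X: "eval_series \<phi> X = X"
  and eval_series_Y: "eval_series \<phi> Y = Y"
  and eval_series_Const: "eval_series \<phi> (Const a) = Const (eval_at of_rat \<phi> a)"
  by (rule fps_fps_eqI; simp add: coeff_eval_series eval_rat_simps coeff_xy_mult coeff_xy_one coeff_xy_X coeff_xy_Y coeff_xy_Const)+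

lemma eval_series_power: "eval_series \<phi> (F ^ n) = eval_series \<phi> F ^ n"
  by (induction n) (simp_all add: eval_series_one eval_series_mult)

lemma eval_series_deriv:
  "eval_series \<phi> (deriv_x F) = deriv_x (eval_series \<phi> F)"
  "eval_series \<phi> (deriv_y F) = deriv_y (eval_series \<phi> F)"
  by (rule fps_fps_eqI; simp add: coeff_eval_series coeff_xy_deriv_x coeff_xy_deriv_y eval_rat_simps)+

lemma eval_series_focal_series:
  "eval_series \<phi> (focal_series s) = focal_series (\<lambda>k. eval_at of_rat \<phi> (s k))"
  by (rule fps_fps_eqI) (auto simp: coeff_eval_series coeff_xy_focal_series eval_rat_simps intro!: sum.cong)

text \<open>Read off from \<open>P0\<close> and \<open>Q0\<close> after expanding \<open>Z\<close>
  and \<open>W\<close> in \<open>X\<close> and \<open>Y\<close>. For real \<open>b\<close>,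
  \<open>c\<close>, \<open>d\<close> some entries are imaginary and nonzero.\<close>

definition special_point :: "complex \<Rightarrow> complex \<Rightarrow> complex \<Rightarrow> indet \<Rightarrow> complex" where
  "special_point b c d v = (case v of
      P20 \<Rightarrow> (1 - b) / 2 | P11 \<Rightarrow> \<i> * b | P02 \<Rightarrow> (1 + b) / 2
    | P30 \<Rightarrow> (c - d - 1) / 2 | P21 \<Rightarrow> \<i> * (3 * d - c - 3) / 2
    | P12 \<Rightarrow> (c + 3 * d + 3) / 2 | P03 \<Rightarrow> \<i> * (1 - c - d) / 2
    | Q20 \<Rightarrow> - \<i> * (1 + b) / 2 | Q11 \<Rightarrow> - b | Q02 \<Rightarrow> - \<i> * (1 - b) / 2
    | Q30 \<Rightarrow> - \<i> * (c + d + 1) / 2 | Q21 \<Rightarrow> (3 - c - 3 * d) / 2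
    | Q12 \<Rightarrow> - \<i> * (c - 3 * d - 3) / 2 | Q03 \<Rightarrow> (d - c - 1) / 2)"

lemma ZW_expand:
  "Z * W^2 = X^3 - Const \<i> * X^2 * Y + X * Y^2 - Const \<i> * Y^3"
  "W^2 = X^2 - 2 * Const \<i> * X * Y - Y^2"
  "W^3 = X^3 - 3 * Const \<i> * X^2 * Y - 3 * X * Y^2 + Const \<i> * Y^3"
  "Z^3 = X^3 + 3 * Const \<i> * X^2 * Y - 3 * X * Y^2 - Const \<i> * Y^3"
  by (simp_all add: Z_def W_def algebra_simps power2_eq_square power3_eq_cube Const_i_squared)

lemma Const_numeral: "Const (numeral n) = numeral n"
  using Const_of_nat[of "numeral n"] by simp

lemma eval_series_P_gen: "eval_series (special_point b c d) P_gen = P0 b c d" (is "?P")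
  and eval_series_Q_gen: "eval_series (special_point b c d) Q_gen = Q0 b c d" (is "?Q")
proof -
  define h where "h = (Const (1/2) :: complex fps fps)"
  have half: "Const (a / 2) = h * Const a" for a
    by (simp add: h_def flip: Const_mult)
  \<comment> \<open>\<open>P11\<close> and \<open>Q11\<close> are the only entries without
    denominator 2; a factor \<open>h\<close> is restored in them so that all nonlinear terms are
    linear in \<open>h\<close>.\<close>
  have double: "Const (\<i> * b) = h * (2 * Const \<i> * Const b)" "Const (- b) = - (h * (2 * Const b))"
  proof -
    have "h * 2 = 1" by (simp add: h_def Const_1 flip: Const_numeral Const_mult)
    then have "h * (2 * F) = F" for F by (simp flip: mult.assoc)
    then show "Const (\<i> * b) = h * (2 * Const \<i> * Const b)" "Const (- b) = - (h * (2 * Const b))"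
      by (simp_all add: Const_mult Const_uminus mult.assoc)
  qed
  note Const_simps = Const_add Const_diff Const_mult Const_uminus Const_1 Const_numeral
  show ?P
    unfolding P_gen_def P0_def eval_series_add eval_series_mult eval_series_power eval_series_X eval_series_Y
      eval_series_Const eval_rat_simps special_point_def indet.case Z_mult_W mult.assoc[of "Const c" Z] ZW_expand(1)
    unfolding ZW_expand double half
    by (simp add: Const_simps algebra_simps)
  have i2: "Const (\<i> / 2) = Const \<i> * h" by (simp add: half mult.commute)
  show ?Q
    unfolding Q_gen_def Q0_def eval_series_add eval_series_mult eval_series_power eval_series_X eval_series_Y
      eval_series_Const eval_rat_simps special_point_def indet.case Z_mult_W mult.assoc[of "Const c" Z] ZW_expand(1)
    unfolding ZW_expand double half i2
    by (simp add: Const_simps algebra_simps Const_i_squared)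
qed

theorem mainTheorem2:
  fixes s :: "nat \<Rightarrow> rat coeff_poly"
  assumes "focal_values s"
  shows "complex_poly (s 12) \<notin> rad (ideal_generated ((\<lambda>j. complex_poly (s j)) ` {1..11}))"
proof
  assume "complex_poly (s 12) \<in> rad (ideal_generated ((\<lambda>j. complex_poly (s j)) ` {1..11}))"
  then obtain n where n: "complex_poly (s 12) ^ n \<in> ideal_generated ((\<lambda>j. complex_poly (s j)) ` {1..11})"
    by (auto simp: rad_def)
  obtain b c d where zero: "integral_coeff b c d 1 4 = 0" "integral_coeff b c d 2 7 = 0" "integral_coeff b c d 3 10 = 0"
    and nonzero: "integral_coeff b c d 4 13 \<noteq> 0"
    using exists_obstruction_zero by blast
  define \<phi> where "\<phi> = special_point (of_real b) (of_real c) (of_real d)"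
  obtain F where F: "\<And>i j. i + j \<le> 2 \<Longrightarrow> coeff_xy F i j = coeff_xy (X^2 + Y^2) i j"
    "deriv_x F * Q_gen - deriv_y F * P_gen = focal_series s"
    using assms by (auto simp: focal_values_def focal_expansion_def)
  \<comment> \<open>Evaluation turns an arbitrary admissible \<open>F\<close> into an admissible
    series \<open>H\<close> of the numerical system.\<close>
  have lie: "lie (P0 (of_real b) (of_real c) (of_real d)) (Q0 (of_real b) (of_real c) (of_real d)) (eval_series \<phi> F)
      = focal_series (\<lambda>k. eval_at of_rat \<phi> (s k))"
    using arg_cong[OF F(2), of "eval_series \<phi>"]
    by (simp add: lie_def \<phi>_def eval_series_diff eval_series_mult eval_series_deriv eval_series_P_gen
        eval_series_Q_gen eval_series_focal_series)
  have "coeff_xy (eval_series \<phi> F) i j = coeff_xy (X^2 + Y^2) i j" if "i + j \<le> 2" for i j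
    using arg_cong[OF F(1)[OF that], of "eval_at of_rat \<phi>"]
    by (simp add: eval_series_add eval_series_power eval_series_X eval_series_Y
        flip: coeff_eval_series del: coeff_xy_add)
  then have low: "vanishes_below 3 (eval_series \<phi> F - (X^2 + Y^2))"
    by (auto simp: vanishes_below_def)
  have v: "- \<i> * complex_of_real (integral_coeff b c d 4 13) \<noteq> 0" using nonzero by simp
  note obstruction = focal_value_obstruction[OF vanishes_below_P0 vanishes_below_Q0 first_integral_lowest low
      lie_first_integral_lowest[OF zero] v lie]
  have "eval_at (\<lambda>x. x) \<phi> (complex_poly (s 12) ^ n) = 0"
    by (rule eval_at_ideal_generated[OF n]) (use obstruction(1) in \<open>auto simp: eval_at_complex_poly\<close>)
  then have "eval_at of_rat \<phi> (s 12) = 0"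
    by (simp add: eval_at_power eval_at_complex_poly)
  with obstruction(2) show False by simp
qed

end
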